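(* Let $\Lambda$ be any locally finite multiset in $\mathbb C$ with finite multiplicities, and let $p\in\{0,1,2\}$. Choose radii $R_k\ge 2k$ such that $$d(R_k)\Bigl(\frac{k}{R_k}\Bigr)^{p+1}\le1,\qquad k\ge1.\tag{$*$}$$ Define $$E_{k,p}(\Lambda)=\min_{a_1,\dots,a_p\in\mathbb C}\frac1\pi\int_{|z|<k}\Bigl|\mathcal B_{\Lambda,R_k}(z)e^{\sum_{j=1}^pa_jz^j}\Bigr|^2e^{-|z|^2}\,dA(z),$$ where for $p=0$ the exponential is $1$ and no minimization is taken. Then the finite-dimensional minima are attained, and $$\lim_{k\to\infty}E_{k,p}(\Lambda)=M(\Lambda)\quad\text{in }[0,+\infty].$$ In particular, $\Lambda$ is a zero set for $\mathcal F^2$ if and only if $\lim_{k\to\infty}E_{k,p}(\Lambda)<\infty$. When $M(\Lambda)<\infty$, there is a unique function $f_\Lambda\in\mathcal F^2$ with $\mathcal Z(f_\Lambda)=\Lambda$, $[z^{m_0}]f_\Lambda=1$ and $\|f_\Lambda\|_2^2=M(\Lambda)$, and every choice of minimizing functions $\mathcal B_{\Lambda,R_k}(z)e^{\sum_{j=1}^pa_jz^j}$ in the definition of $E_{k,p}(\Lambda)$ converges, as $k\to\infty$, locally uniformly to $f_\Lambda$ on $\mathbb C$. Radii satisfying $( * )$ can be chosen under the following hypotheses: for $p=2$, with no hypothesis (one may take $R_k=2k^3$); for $p=1$, if $\liminf_{R\to\infty}\delta(R)/R^2=0$; for $p=0$, if $\liminf_{R\to\infty}\delta(R)/R=0$.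
   Context: $dA$ is planar Lebesgue measure. The Bargmann–Fock space $\mathcal F^2$ is the space of entire functions $f$ with $\|f\|_2^2=\frac1\pi\int_{\mathbb C}|f|^2e^{-|z|^2}dA<\infty$. For a nonzero entire $f$, $\mathcal Z(f)$ is its zero multiset with multiplicities; $[z^m]f$ is the $m$th Taylor coefficient at $0$. $\Lambda$ is a zero set for $\mathcal F^2$ if $\mathcal Z(f)=\Lambda$ for some nonzero $f\in\mathcal F^2$. $m_\lambda$ is the multiplicity of $\lambda$ in $\Lambda$ and $m_0$ that of $0$ (possibly $0$); sums and products with explicit $m_\lambda$ use each support point once. Put $$J_\Lambda(r)=m_0\log r+\sum_{0<|\lambda|\le r}m_\lambda\log\frac r{|\lambda|},\qquad \delta(R)=\max\{0,R^2/2-J_\Lambda(R)\},\qquad d(R)=1+\delta(R)\quad(R\ge2).$$ For $R\ge2$ the normalized finite Blaschke product is $$\mathcal B_{\Lambda,R}(z)=z^{m_0}\prod_{0<|\lambda|<R}\Bigl(\frac{1-z/\lambda}{1-\overline\lambda z/R^2}\Bigr)^{m_\lambda},\qquad|z|<R.$$ The normalized extremal value is $$M(\Lambda)=\inf\{\|f\|_2^2: f\in\mathcal F^2,\ \mathcal Z(f)=\Lambda,\ [z^{m_0}]f=1\},\qquad\inf\varnothing=+\infty.$$ *)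

theory Defs
  imports "HOL-Complex_Analysis.Complex_Analysis"
begin

text \<open>A multiset in the complex plane with finite multiplicities is represented by its multiplicity
  function \<open>\<Lambda> :: complex \<Rightarrow> nat\<close>; multisets of the library type are finite and would not do.
  Nonnegative integrals, infima and limits are taken in \<^typ>\<open>ennreal\<close>, so that infinite values
  are meaningful and \<open>Inf {} = \<infinity>\<close>.\<close>

definition locally_finite :: "(complex \<Rightarrow> nat) \<Rightarrow> bool" where
  "locally_finite \<Lambda> \<longleftrightarrow> (\<forall>r. finite {w. cmod w \<le> r \<and> 0 < \<Lambda> w})"

definition gauss_normsq :: "complex set \<Rightarrow> (complex \<Rightarrow> complex) \<Rightarrow> ennreal" where
  "gauss_normsq S f =
     ennreal (1 / pi) * (\<integral>\<^sup>+ z\<in>S. ennreal ((cmod (f z))\<^sup>2 * exp (- (cmod z)\<^sup>2)) \<partial>lborel)"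

definition fock_space :: "(complex \<Rightarrow> complex) set" where
  "fock_space = {f. f holomorphic_on UNIV \<and> gauss_normsq UNIV f < \<infinity>}"

text \<open>For a nonzero entire \<open>f\<close>, \<^term>\<open>zorder f z\<close> is the multiplicity of \<open>z\<close> as a zero
  (and \<open>0\<close> where \<open>f\<close> does not vanish); it is unspecified for \<open>f = 0\<close>, whence the second conjunct.\<close>

definition has_zeros :: "(complex \<Rightarrow> complex) \<Rightarrow> (complex \<Rightarrow> nat) \<Rightarrow> bool" where
  "has_zeros f \<Lambda> \<longleftrightarrow>
     f holomorphic_on UNIV \<and> (\<exists>z. f z \<noteq> 0) \<and> (\<forall>z. zorder f z = int (\<Lambda> z))"

definition fock_zero_set :: "(complex \<Rightarrow> nat) \<Rightarrow> bool" where
  "fock_zero_set \<Lambda> \<longleftrightarrow> (\<exists>f\<in>fock_space. has_zeros f \<Lambda>)"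

definition jensen_sum :: "(complex \<Rightarrow> nat) \<Rightarrow> real \<Rightarrow> real" where
  "jensen_sum \<Lambda> r = real (\<Lambda> 0) * ln r
     + (\<Sum>w | 0 < cmod w \<and> cmod w \<le> r \<and> 0 < \<Lambda> w. real (\<Lambda> w) * ln (r / cmod w))"

definition delta :: "(complex \<Rightarrow> nat) \<Rightarrow> real \<Rightarrow> real" where
  "delta \<Lambda> R = max 0 (R\<^sup>2 / 2 - jensen_sum \<Lambda> R)"

definition defect :: "(complex \<Rightarrow> nat) \<Rightarrow> real \<Rightarrow> real" where
  "defect \<Lambda> R = 1 + delta \<Lambda> R"

text \<open>The Blaschke product is only meaningful on \<open>ball 0 R\<close>; outside, the formula below takes
  irrelevant values.\<close>

definition blaschke :: "(complex \<Rightarrow> nat) \<Rightarrow> real \<Rightarrow> complex \<Rightarrow> complex" where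
  "blaschke \<Lambda> R z = z ^ \<Lambda> 0
     * (\<Prod>w | 0 < cmod w \<and> cmod w < R \<and> 0 < \<Lambda> w.
          ((1 - z / w) / (1 - cnj w * z / complex_of_real (R\<^sup>2))) ^ \<Lambda> w)"

definition normalized_fock :: "(complex \<Rightarrow> nat) \<Rightarrow> (complex \<Rightarrow> complex) set" where
  "normalized_fock \<Lambda> =
     {f \<in> fock_space. has_zeros f \<Lambda> \<and> fps_nth (fps_expansion f 0) (\<Lambda> 0) = 1}"

definition extremal_value :: "(complex \<Rightarrow> nat) \<Rightarrow> ennreal" where
  "extremal_value \<Lambda> = (INF f\<in>normalized_fock \<Lambda>. gauss_normsq UNIV f)"

definition admissible_radii :: "(complex \<Rightarrow> nat) \<Rightarrow> nat \<Rightarrow> (nat \<Rightarrow> real) \<Rightarrow> bool" where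
  "admissible_radii \<Lambda> p R \<longleftrightarrow>
     (\<forall>k\<ge>1. 2 * real k \<le> R k \<and> defect \<Lambda> (R k) * (real k / R k) ^ (p + 1) \<le> 1)"

text \<open>The parameters \<open>a\<^sub>1, \<dots>, a\<^sub>p\<close> are the values at \<open>1, \<dots>, p\<close> of a sequence; its other entries
  play no role. For \<open>p = 0\<close> the exponential factor is \<open>1\<close>.\<close>

definition competitor ::
  "(complex \<Rightarrow> nat) \<Rightarrow> nat \<Rightarrow> real \<Rightarrow> (nat \<Rightarrow> complex) \<Rightarrow> complex \<Rightarrow> complex" where
  "competitor \<Lambda> p R a z = blaschke \<Lambda> R z * exp (\<Sum>j=1..p. a j * z ^ j)"

text \<open>\<open>finite_min \<Lambda> p R k\<close> is defined as an infimum, with \<open>R\<close> the whole sequence of radii; that the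
  infimum is a minimum is expressed by the existence of \<open>a\<close> with \<open>is_minimizer \<Lambda> p R k a\<close>.\<close>

definition finite_min :: "(complex \<Rightarrow> nat) \<Rightarrow> nat \<Rightarrow> (nat \<Rightarrow> real) \<Rightarrow> nat \<Rightarrow> ennreal" where
  "finite_min \<Lambda> p R k = (INF a. gauss_normsq (ball 0 (real k)) (competitor \<Lambda> p (R k) a))"

definition is_minimizer ::
  "(complex \<Rightarrow> nat) \<Rightarrow> nat \<Rightarrow> (nat \<Rightarrow> real) \<Rightarrow> nat \<Rightarrow> (nat \<Rightarrow> complex) \<Rightarrow> bool" where
  "is_minimizer \<Lambda> p R k a \<longleftrightarrow>
     gauss_normsq (ball 0 (real k)) (competitor \<Lambda> p (R k) a) = finite_min \<Lambda> p R k"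

definition is_extremal :: "(complex \<Rightarrow> nat) \<Rightarrow> (complex \<Rightarrow> complex) \<Rightarrow> bool" where
  "is_extremal \<Lambda> f \<longleftrightarrow> f \<in> normalized_fock \<Lambda> \<and> gauss_normsq UNIV f = extremal_value \<Lambda>"

end

theory Submission
  imports Defs "HOL-Library.Diagonal_Subsequence"
begin

text \<open>
  Let \<open>f\<close> have zero multiset \<open>\<Lambda>\<close> and leading Taylor coefficient \<open>1\<close>. On the disc \<open>\<bar>z\<bar> < R\<close> it is
  \<open>B e\<^sup>g\<close>, where \<open>B\<close> is the Blaschke product and \<open>g(0) = 0\<close>. By Jensen, \<open>\<bar>B\<bar> = exp J(R)\<close> on the
  circle \<open>\<bar>z\<bar> = R\<close>, while membership in the Fock space gives \<open>\<bar>f(z)\<bar> \<le> exp (C + \<bar>z\<bar>\<^sup>2 / 2)\<close>; hence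
  \<open>Re g \<le> C + \<delta>(R)\<close> on the disc, by the maximum principle. The Borel--Caratheodory inequality turns
  this one-sided bound into bounds for the Taylor coefficients of \<open>g\<close>, so that on \<open>\<bar>z\<bar> \<le> R / 2\<close>
  the Taylor polynomial of degree \<open>p\<close> misses \<open>g\<close> by \<open>O(d(R) (\<bar>z\<bar> / R)\<^bsup>p+1\<^esup>)\<close>. The condition on the
  radii makes this \<open>O((\<bar>z\<bar> / k)\<^bsup>p+1\<^esup>)\<close> for \<open>\<bar>z\<bar> < k\<close>: uniformly bounded there, and tending to \<open>0\<close>
  at each point. The competitor built from that polynomial is therefore \<open>f\<close> times a bounded factor
  that tends to \<open>1\<close>, and dominated convergence gives \<open>limsup E\<^sub>k \<le> \<parallel>f\<parallel>\<^sup>2\<close>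
  (\<open>normalized_fock_factorization\<close>, \<open>Taylor_remainder_bound\<close>,
  \<open>competitors_approximating_normalized_fock\<close>).

  Conversely, competitors with bounded norms are locally bounded, so by Montel's theorem a
  subsequence converges locally uniformly to an entire function. By Hurwitz's theorem, applied to the
  quotients by a fixed Blaschke product, the limit still has divisor \<open>\<Lambda>\<close> and leading coefficient
  \<open>1\<close>, and by Fatou's lemma its norm is at most the lower limit of theirs
  (\<open>normalized_limit_of_disc_divisors\<close>). This yields \<open>liminf E\<^sub>k \<ge> M(\<Lambda>)\<close>, the existence of an
  extremal function, and the fact that every subsequence of minimizers has a further subsequence
  converging to some extremal function.

  There is only one (\<open>extremal_unique\<close>): if \<open>f\<^sub>1\<close>, \<open>f\<^sub>2\<close> are extremal then \<open>f\<^sub>1 / f\<^sub>2\<close> is zero-free,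
  so their geometric mean \<open>F\<close> is an entire competitor, and
  \<open>\<bar>f\<^sub>1\<bar>\<^sup>2 + \<bar>f\<^sub>2\<bar>\<^sup>2 = 2 \<bar>F\<bar>\<^sup>2 + (\<bar>f\<^sub>1\<bar> - \<bar>f\<^sub>2\<bar>)\<^sup>2\<close> forces \<open>\<bar>f\<^sub>1\<bar> = \<bar>f\<^sub>2\<bar>\<close>. So the full sequence of
  minimizers converges.

  The finite-dimensional minima are attained (\<open>finite_min_attained\<close>) because a bound on the norm
  bounds \<open>Re\<close> of the exponent polynomial on a small disc, hence its coefficients, and the norm is
  lower semicontinuous in them.
\<close>

section \<open>An area mean value inequality\<close>

text \<open>Cauchy's formula for \<open>G z\<close> on a circle of radius \<open>s / 4\<close> whose centre \<open>c\<close> is near \<open>z\<close> but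
  otherwise free. Moving the centre instead of the radius lets the integration over \<open>c\<close> in the next
  lemma use the translation invariance of Lebesgue measure in place of polar coordinates. As \<open>z\<close> lies
  within half a radius of \<open>c\<close>, the Cauchy kernel costs at most a factor \<open>2\<close>.\<close>

lemma circle_mean_bound:
  fixes G :: "complex \<Rightarrow> complex"
  assumes holG: "G holomorphic_on ball z s" and s: "s > 0" and c: "cmod (c - z) < s / 8"
  shows "ennreal (cmod (G z)) \<le>
    2 * (\<integral>\<^sup>+\<theta>\<in>{0..1}. ennreal (cmod (G (c + of_real (s / 4) * exp (2 * of_real pi * \<i> * of_real \<theta>)))) \<partial>lborel)"
proof -
  define \<rho> where "\<rho> = s / 4"
  have \<rho>: "\<rho> > 0" using s by (simp add: \<rho>_def)
  define \<gamma> where "\<gamma> = (\<lambda>\<theta>. c + of_real \<rho> * exp (2 * of_real pi * \<i> * of_real \<theta>))"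
  have sub: "cball c \<rho> \<subseteq> ball z s"
  proof
    fix w assume "w \<in> cball c \<rho>"
    then have "cmod (c - w) \<le> s / 4" by (simp add: dist_norm \<rho>_def)
    moreover have "cmod (z - w) \<le> cmod (c - z) + cmod (c - w)"
      by (metis dist_commute dist_norm dist_triangle)
    ultimately show "w \<in> ball z s" using c s by (simp add: dist_norm)
  qed
  have z_in: "z \<in> ball c \<rho>" using c s by (simp add: dist_norm \<rho>_def)
  have contG: "continuous_on (cball c \<rho>) G"
    using holomorphic_on_imp_continuous_on[OF holG] continuous_on_subset sub by blast
  have holb: "G holomorphic_on ball c \<rho>"
    by (rule holomorphic_on_subset[OF holG subset_trans[OF ball_subset_cball sub]])
  have "((\<lambda>u. G u / (u - z)) has_contour_integral (2 * of_real pi * \<i> * G z)) (circlepath c \<rho>)"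
    by (rule Cauchy_integral_circlepath[OF contG holb])
       (use z_in in \<open>auto simp: dist_norm norm_minus_commute\<close>)
  then have hi: "((\<lambda>x. G (circlepath c \<rho> x) / (circlepath c \<rho> x - z) *
                  vector_derivative (circlepath c \<rho>) (at x within {0..1}))
              has_integral 2 * of_real pi * \<i> * G z) {0..1}"
    by (simp add: has_contour_integral_def)
  have on_sphere: "cmod (\<gamma> \<theta> - c) = \<rho>" for \<theta>
    using \<rho> by (simp add: \<gamma>_def norm_mult)
  have in_ball: "\<gamma> \<theta> \<in> cball c \<rho>" for \<theta>
    using on_sphere[of \<theta>] by (simp add: dist_norm norm_minus_commute)
  have cont\<gamma>: "continuous_on {0..1} (\<lambda>\<theta>. cmod (G (\<gamma> \<theta>)))"
  proof (intro continuous_on_norm)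
    show "continuous_on {0..1} (\<lambda>\<theta>. G (\<gamma> \<theta>))"
      by (rule continuous_on_compose2[OF contG _ image_subsetI[OF in_ball]])
         (unfold \<gamma>_def, intro continuous_intros)
  qed
  have gint: "((\<lambda>\<theta>. 4 * pi * cmod (G (\<gamma> \<theta>))) has_integral
                4 * pi * integral {0..1} (\<lambda>\<theta>. cmod (G (\<gamma> \<theta>)))) {0..1}"
    by (intro has_integral_mult_right integrable_integral integrable_continuous_interval cont\<gamma>)
  have bnd: "cmod (G (circlepath c \<rho> x) / (circlepath c \<rho> x - z) *
                  vector_derivative (circlepath c \<rho>) (at x within {0..1}))
              \<le> 4 * pi * cmod (G (\<gamma> x))" if x: "x \<in> {0..1}" for x
  proof -
    have cp: "circlepath c \<rho> x = \<gamma> x"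
      by (simp add: circlepath_def part_circlepath_def linepath_def \<gamma>_def algebra_simps)
    have vd: "cmod (vector_derivative (circlepath c \<rho>) (at x within {0..1})) = 2 * pi * \<rho>"
      using x \<rho> by (simp add: vector_derivative_circlepath01 norm_mult)
    have "cmod (\<gamma> x - z) \<ge> cmod (\<gamma> x - c) - cmod (c - z)"
      by (metis add_diff_cancel_right' diff_add_cancel norm_diff_ineq add_diff_eq)
    then have d: "cmod (\<gamma> x - z) \<ge> \<rho> / 2" using on_sphere[of x] c by (simp add: \<rho>_def)
    have "2 * pi * \<rho> / cmod (\<gamma> x - z) \<le> 2 * pi * \<rho> / (\<rho> / 2)"
      by (intro divide_left_mono d mult_pos_pos) (use \<rho> d in auto)
    also have "\<dots> = 4 * pi" using \<rho> by simp
    finally have k: "2 * pi * \<rho> / cmod (\<gamma> x - z) \<le> 4 * pi" .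
    have "cmod (G (\<gamma> x)) * (2 * pi * \<rho> / cmod (\<gamma> x - z)) \<le> cmod (G (\<gamma> x)) * (4 * pi)"
      by (intro mult_left_mono k) auto
    then show ?thesis unfolding cp by (simp add: norm_mult norm_divide vd field_simps)
  qed
  have "cmod (2 * of_real pi * \<i> * G z) \<le> 4 * pi * integral {0..1} (\<lambda>\<theta>. cmod (G (\<gamma> \<theta>)))"
    using integral_norm_bound_integral[OF has_integral_integrable[OF hi] has_integral_integrable[OF gint] bnd]
    unfolding integral_unique[OF hi] integral_unique[OF gint] .
  then have real_le: "cmod (G z) \<le> 2 * integral {0..1} (\<lambda>\<theta>. cmod (G (\<gamma> \<theta>)))"
    by (simp add: norm_mult)
  have nn: "(\<integral>\<^sup>+\<theta>\<in>{0..1}. ennreal (cmod (G (\<gamma> \<theta>))) \<partial>lborel) =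
        ennreal (integral {0..1} (\<lambda>\<theta>. cmod (G (\<gamma> \<theta>))))"
  proof -
    have "(\<lambda>\<theta>. indicator {0..1} \<theta> *\<^sub>R cmod (G (\<gamma> \<theta>))) \<in> borel_measurable borel"
      by (intro borel_measurable_continuous_on_indicator cont\<gamma>) auto
    moreover have "((\<lambda>\<theta>. indicator {0..1} \<theta> *\<^sub>R cmod (G (\<gamma> \<theta>))) has_integral
        integral {0..1} (\<lambda>\<theta>. cmod (G (\<gamma> \<theta>)))) UNIV"
    proof -
      have "((\<lambda>\<theta>. cmod (G (\<gamma> \<theta>))) has_integral integral {0..1} (\<lambda>\<theta>. cmod (G (\<gamma> \<theta>)))) {0..1}"
        by (intro integrable_integral integrable_continuous_interval cont\<gamma>)
      moreover have "(\<lambda>\<theta>. indicator {0..1} \<theta> *\<^sub>R cmod (G (\<gamma> \<theta>))) =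
          (\<lambda>\<theta>. if \<theta> \<in> {0..1} then cmod (G (\<gamma> \<theta>)) else 0)"
        by (auto simp: indicator_def fun_eq_iff)
      ultimately show ?thesis by (simp only: has_integral_restrict_UNIV)
    qed
    ultimately have "(\<integral>\<^sup>+\<theta>. ennreal (indicator {0..1} \<theta> *\<^sub>R cmod (G (\<gamma> \<theta>))) \<partial>lborel) =
        ennreal (integral {0..1} (\<lambda>\<theta>. cmod (G (\<gamma> \<theta>))))"
      by (intro nn_integral_has_integral_lborel) auto
    then show ?thesis
      by (simp add: ennreal_mult'' ennreal_indicator mult.commute)
  qed
  have "ennreal (cmod (G z)) \<le> ennreal (2 * integral {0..1} (\<lambda>\<theta>. cmod (G (\<gamma> \<theta>))))"
    by (intro ennreal_leI real_le)
  also have "\<dots> = 2 * (\<integral>\<^sup>+\<theta>\<in>{0..1}. ennreal (cmod (G (\<gamma> \<theta>))) \<partial>lborel)"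
    by (subst nn) (simp add: ennreal_mult')
  finally show ?thesis by (simp add: \<gamma>_def \<rho>_def)
qed

text \<open>Averaging the previous bound over the centres \<open>c\<close> in \<open>ball z (s / 8)\<close>: for each fixed angle the
  translated discs stay inside \<open>ball z s\<close>, so every angle contributes at most the full area
  integral.\<close>

lemma area_mean_bound:
  fixes G :: "complex \<Rightarrow> complex"
  assumes holG: "G holomorphic_on ball z s" and s: "s > 0"
  shows "ennreal (cmod (G z)) * ennreal (pi * (s / 8)\<^sup>2) \<le>
           2 * (\<integral>\<^sup>+w\<in>ball z s. ennreal (cmod (G w)) \<partial>lborel)"
proof -
  define H :: "complex \<Rightarrow> ennreal" where "H = (\<lambda>w. ennreal (cmod (G w)) * indicator (ball z s) w)"
  have H_meas [measurable]: "H \<in> borel_measurable borel"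
  proof -
    have "(\<lambda>w. indicator (ball z s) w *\<^sub>R cmod (G w)) \<in> borel_measurable borel"
      by (intro borel_measurable_continuous_on_indicator continuous_on_norm
            holomorphic_on_imp_continuous_on holG) auto
    then have "(\<lambda>w. ennreal (indicator (ball z s) w *\<^sub>R cmod (G w))) \<in> borel_measurable borel"
      by measurable
    then show ?thesis
      by (simp add: H_def ennreal_mult'' ennreal_indicator mult.commute)
  qed
  \<comment> \<open>extended by \<open>0\<close>, the integrand is defined at every translate, so Tonelli's theorem applies on the
     whole product space\<close>
  define e :: "real \<Rightarrow> complex" where "e = (\<lambda>\<theta>. of_real (s / 4) * exp (2 * of_real pi * \<i> * of_real \<theta>))"
  have e_meas [measurable]: "e \<in> borel_measurable borel"
    unfolding e_def by (intro borel_measurable_continuous_onI continuous_intros)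
  have area: "emeasure lborel (ball z (s / 8)) = ennreal (pi * (s / 8)\<^sup>2)"
    using emeasure_ball[of "s / 8" z] s by (simp add: unit_ball_vol_2)
  have pt: "ennreal (cmod (G z)) * indicator (ball z (s / 8)) c \<le>
      2 * (\<integral>\<^sup>+\<theta>. H (c + e \<theta>) * indicator {0..1} \<theta> \<partial>lborel)" for c
  proof (cases "c \<in> ball z (s / 8)")
    case True
    then have c: "cmod (c - z) < s / 8" by (simp add: dist_norm norm_minus_commute)
    have in_ball: "c + e \<theta> \<in> ball z s" for \<theta>
    proof -
      have "cmod (c + e \<theta> - z) \<le> cmod (c - z) + cmod (e \<theta>)"
        by (metis add_diff_eq add.commute norm_triangle_ineq)
      also have "cmod (e \<theta>) = s / 4" using s by (simp add: e_def norm_mult)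
      finally show ?thesis using c s by (simp add: dist_norm norm_minus_commute)
    qed
    show ?thesis using circle_mean_bound[OF holG s c] True in_ball by (simp add: H_def e_def)
  qed auto
  have "ennreal (cmod (G z)) * ennreal (pi * (s / 8)\<^sup>2) =
        (\<integral>\<^sup>+c. ennreal (cmod (G z)) * indicator (ball z (s / 8)) c \<partial>lborel)"
    by (simp add: nn_integral_cmult_indicator area)
  also have "\<dots> \<le> (\<integral>\<^sup>+c. 2 * (\<integral>\<^sup>+\<theta>. H (c + e \<theta>) * indicator {0..1} \<theta> \<partial>lborel) \<partial>lborel)"
    by (intro nn_integral_mono pt)
  also have "\<dots> = 2 * (\<integral>\<^sup>+c. (\<integral>\<^sup>+\<theta>. H (c + e \<theta>) * indicator {0..1} \<theta> \<partial>lborel) \<partial>lborel)"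
    by (intro nn_integral_cmult) measurable
  also have "(\<integral>\<^sup>+c. (\<integral>\<^sup>+\<theta>. H (c + e \<theta>) * indicator {0..1} \<theta> \<partial>lborel) \<partial>lborel) =
      (\<integral>\<^sup>+\<theta>. (\<integral>\<^sup>+c. H (c + e \<theta>) * indicator {0..1} \<theta> \<partial>lborel) \<partial>lborel)"
    by (intro lborel_pair.Fubini'[symmetric]) measurable
  also have "\<dots> = (\<integral>\<^sup>+\<theta>. (\<integral>\<^sup>+c. H c \<partial>lborel) * indicator {0..1} (\<theta> :: real) \<partial>lborel)"
  proof (intro nn_integral_cong)
    fix \<theta> :: real
    have "(\<integral>\<^sup>+c. H (c + e \<theta>) \<partial>lborel) = (\<integral>\<^sup>+c. H c \<partial>distr lborel borel ((+) (e \<theta>)))"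
      by (subst nn_integral_distr) (auto simp: add.commute)
    also have "\<dots> = (\<integral>\<^sup>+c. H c \<partial>lborel)" by (simp add: lborel_distr_plus)
    finally show "(\<integral>\<^sup>+c. H (c + e \<theta>) * indicator {0..1} \<theta> \<partial>lborel) =
        (\<integral>\<^sup>+c. H c \<partial>lborel) * indicator {0..1} \<theta>"
      by (subst nn_integral_multc) auto
  qed
  also have "\<dots> = (\<integral>\<^sup>+c. H c \<partial>lborel)" by (simp add: nn_integral_cmult_indicator)
  finally show ?thesis by (simp add: H_def)
qed

text \<open>The twisted function \<open>h w \<cdot> exp (- cnj z (w - z))\<close> has, up to the constant
  \<open>exp (\<bar>z\<bar>\<^sup>2)\<close> and a factor between \<open>1\<close> and \<open>e\<close>, modulus squared equal to the Gaussian density of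
  \<open>h\<close> near \<open>z\<close>. Applying the area bound to it keeps the exact exponent \<open>\<bar>z\<bar>\<^sup>2\<close>, which
  is what later produces \<open>R\<^sup>2 / 2\<close> in the defect with no logarithmic loss.\<close>

lemma gauss_pointwise_bound:
  assumes hol: "h holomorphic_on ball z s" and s: "0 < s" "s \<le> 1" and S: "ball z s \<subseteq> S"
    and M: "gauss_normsq S h \<le> ennreal M" and M0: "M \<ge> 0"
  shows "(cmod (h z))\<^sup>2 \<le> 128 * exp 1 / s\<^sup>2 * M * exp ((cmod z)\<^sup>2)"
proof -
  define G where "G = (\<lambda>w. (h w * exp (- cnj z * (w - z)))\<^sup>2)"
  have holG: "G holomorphic_on ball z s"
    unfolding G_def by (intro holomorphic_intros hol)
  have Gz: "cmod (G z) = (cmod (h z))\<^sup>2" by (simp add: G_def norm_power)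
  have Gw: "cmod (G w) \<le> exp (1 + (cmod z)\<^sup>2) * ((cmod (h w))\<^sup>2 * exp (- (cmod w)\<^sup>2))"
    if w: "w \<in> ball z s" for w
  proof -
    have "(cmod (w - z))\<^sup>2 \<le> 1"
      using w s by (auto simp: dist_norm norm_minus_commute intro!: power_le_one)
    moreover have "(cmod w)\<^sup>2 = (cmod z)\<^sup>2 + 2 * Re (cnj z * (w - z)) + (cmod (w - z))\<^sup>2"
      unfolding cmod_power2 by (simp add: power2_eq_square algebra_simps)
    ultimately have le: "- 2 * Re (cnj z * (w - z)) \<le> 1 + (cmod z)\<^sup>2 - (cmod w)\<^sup>2" by simp
    have "cmod (G w) = (cmod (h w))\<^sup>2 * (exp (- Re (cnj z * (w - z))))\<^sup>2"
      by (simp add: G_def norm_power norm_mult power_mult_distrib)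
    also have "(exp (- Re (cnj z * (w - z))))\<^sup>2 = exp (- 2 * Re (cnj z * (w - z)))"
      by (simp add: exp_double[symmetric])
    also have "(cmod (h w))\<^sup>2 * \<dots> \<le> (cmod (h w))\<^sup>2 * exp (1 + (cmod z)\<^sup>2 - (cmod w)\<^sup>2)"
      using le by (intro mult_left_mono) auto
    finally show ?thesis by (simp add: exp_diff exp_add exp_minus field_simps)
  qed
  define I where "I = (\<integral>\<^sup>+w\<in>S. ennreal ((cmod (h w))\<^sup>2 * exp (- (cmod w)\<^sup>2)) \<partial>lborel)"
  have gI: "gauss_normsq S h = ennreal (1 / pi) * I" by (simp add: gauss_normsq_def I_def)
  have I: "I \<le> ennreal (pi * M)"
  proof -
    have "I = ennreal pi * (ennreal (1 / pi) * I)"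
      by (simp add: mult.assoc[symmetric] ennreal_mult[symmetric])
    also have "\<dots> \<le> ennreal pi * ennreal M"
      using M by (intro mult_left_mono) (auto simp: gI)
    finally show ?thesis using M0 by (simp add: ennreal_mult)
  qed
  define C where "C = exp (1 + (cmod z)\<^sup>2)"
  have C: "C > 0" by (simp add: C_def)
  define K where "K = (\<lambda>w. indicator (ball z s) w *\<^sub>R ((cmod (h w))\<^sup>2 * exp (- (cmod w)\<^sup>2)))"
  have K [measurable]: "K \<in> borel_measurable borel"
    unfolding K_def
    by (intro borel_measurable_continuous_on_indicator continuous_intros
        holomorphic_on_imp_continuous_on hol) auto
  have "ennreal ((cmod (h z))\<^sup>2 * (pi * (s / 8)\<^sup>2)) = ennreal (cmod (G z)) * ennreal (pi * (s / 8)\<^sup>2)"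
    by (simp add: Gz ennreal_mult)
  also have "\<dots> \<le> 2 * (\<integral>\<^sup>+w\<in>ball z s. ennreal (cmod (G w)) \<partial>lborel)"
    by (rule area_mean_bound[OF holG s(1)])
  also have "(\<integral>\<^sup>+w\<in>ball z s. ennreal (cmod (G w)) \<partial>lborel) \<le> (\<integral>\<^sup>+w. ennreal C * ennreal (K w) \<partial>lborel)"
    using Gw by (intro nn_integral_mono)
      (auto simp: K_def C_def ennreal_mult[symmetric] indicator_def intro!: ennreal_leI)
  also have "\<dots> = ennreal C * (\<integral>\<^sup>+w. ennreal (K w) \<partial>lborel)"
    by (intro nn_integral_cmult) measurable
  also have "(\<integral>\<^sup>+w. ennreal (K w) \<partial>lborel) \<le> I"
    unfolding I_def K_def using S by (intro nn_integral_mono) (auto simp: indicator_def)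
  finally have "ennreal ((cmod (h z))\<^sup>2 * (pi * (s / 8)\<^sup>2)) \<le> 2 * (ennreal C * I)"
    by (simp add: mult_left_mono)
  also have "\<dots> \<le> 2 * (ennreal C * ennreal (pi * M))"
    by (intro mult_left_mono I) auto
  also have "\<dots> = ennreal (2 * (C * (pi * M)))"
    using C M0 by (simp add: ennreal_mult)
  finally have "(cmod (h z))\<^sup>2 * (pi * (s / 8)\<^sup>2) \<le> 2 * (C * (pi * M))"
    using C M0 by (subst (asm) ennreal_le_iff) auto
  then have "pi * ((cmod (h z))\<^sup>2 * s\<^sup>2) \<le> pi * (128 * C * M)"
    by (simp add: power_divide field_simps)
  then have "(cmod (h z))\<^sup>2 * s\<^sup>2 \<le> 128 * C * M" by simp
  then have "(cmod (h z))\<^sup>2 \<le> 128 * C * M / s\<^sup>2" using s by (simp add: pos_le_divide_eq)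
  then show ?thesis by (simp add: C_def exp_add mult_ac)
qed

section \<open>Blaschke products\<close>

abbreviation inner_zeros :: "(complex \<Rightarrow> nat) \<Rightarrow> real \<Rightarrow> complex set" where
  "inner_zeros \<Lambda> R \<equiv> {w. 0 < cmod w \<and> cmod w < R \<and> 0 < \<Lambda> w}"

text \<open>The product is holomorphic off its poles, in particular across the circle \<open>\<bar>z\<bar> = R\<close>. Working
  on this open set, and not only on the disc, makes the quotient \<open>f / B\<close> available on the closed disc
  even when \<open>f\<close> has zeros on the circle.\<close>

definition blaschke_domain :: "(complex \<Rightarrow> nat) \<Rightarrow> real \<Rightarrow> complex set" where
  "blaschke_domain \<Lambda> R = {z. \<forall>w\<in>inner_zeros \<Lambda> R. 1 - cnj w * z / complex_of_real (R\<^sup>2) \<noteq> 0}"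

lemma finite_inner_zeros: "locally_finite \<Lambda> \<Longrightarrow> finite (inner_zeros \<Lambda> R)"
  unfolding locally_finite_def by (erule allE[of _ R], erule rev_finite_subset) auto

lemma blaschke_denominator_nonzero:
  assumes "cmod w < R" "cmod z \<le> R"
  shows "1 - cnj w * z / complex_of_real (R\<^sup>2) \<noteq> 0"
proof
  assume "1 - cnj w * z / complex_of_real (R\<^sup>2) = 0"
  moreover have R: "R > 0" using assms norm_ge_zero[of w] by linarith
  ultimately have "cnj w * z = of_real (R\<^sup>2)" by (simp add: field_simps)
  then have "cmod w * cmod z = R\<^sup>2"
    by (metis complex_mod_cnj norm_mult norm_of_real abs_power2)
  moreover have "cmod w * cmod z \<le> cmod w * R" using assms by (intro mult_left_mono) auto
  moreover have "cmod w * R < R * R" using assms R by simp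
  ultimately show False by (simp add: power2_eq_square)
qed

lemma cball_subset_blaschke_domain: "cball 0 R \<subseteq> blaschke_domain \<Lambda> R"
  unfolding blaschke_domain_def
  by (intro subsetI CollectI ballI blaschke_denominator_nonzero) auto

lemma ball_subset_blaschke_domain: "r \<le> R \<Longrightarrow> ball 0 r \<subseteq> blaschke_domain \<Lambda> R"
  using cball_subset_blaschke_domain[of R \<Lambda>] by force

lemma open_blaschke_domain:
  assumes "locally_finite \<Lambda>"
  shows "open (blaschke_domain \<Lambda> R)"
proof -
  have "blaschke_domain \<Lambda> R =
      (\<Inter>w\<in>inner_zeros \<Lambda> R. - ((\<lambda>z. 1 - cnj w * z / complex_of_real (R\<^sup>2)) -` {0}))"
    by (auto simp: blaschke_domain_def)
  also have "open \<dots>"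
    by (intro open_INT finite_inner_zeros assms ballI open_Compl closed_vimage)
       (auto intro!: continuous_intros simp: divide_inverse)
  finally show ?thesis .
qed

lemma blaschke_holomorphic [holomorphic_intros]:
  "S \<subseteq> blaschke_domain \<Lambda> R \<Longrightarrow> blaschke \<Lambda> R holomorphic_on S"
  unfolding blaschke_def by (intro holomorphic_intros) (auto simp: blaschke_domain_def)

lemma blaschke_eq_0_iff:
  assumes "locally_finite \<Lambda>" "z \<in> blaschke_domain \<Lambda> R" "R > 0"
  shows "blaschke \<Lambda> R z = 0 \<longleftrightarrow> cmod z < R \<and> \<Lambda> z > 0"
  using assms finite_inner_zeros[OF assms(1), of R]
  by (auto simp: blaschke_def blaschke_domain_def)

lemma blaschke_eventually_nonzero:
  assumes "locally_finite \<Lambda>" "z \<in> blaschke_domain \<Lambda> R" "R > 0"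
  shows "eventually (\<lambda>u. blaschke \<Lambda> R u \<noteq> 0) (at z)"
proof -
  have "finite (insert 0 (inner_zeros \<Lambda> R) - {z})" using finite_inner_zeros[OF assms(1)] by blast
  then have "open (- (insert 0 (inner_zeros \<Lambda> R) - {z}))"
    by (meson finite_imp_closed open_Compl)
  then have "eventually (\<lambda>u. u \<in> - (insert 0 (inner_zeros \<Lambda> R) - {z})) (at z)"
    by (intro eventually_at_in_open') auto
  moreover have "eventually (\<lambda>u. u \<in> blaschke_domain \<Lambda> R) (at z)"
    by (intro eventually_at_in_open' open_blaschke_domain assms)
  moreover have "eventually (\<lambda>u. u \<noteq> z) (at z)" by (simp add: eventually_at_filter)
  ultimately show ?thesis
    by eventually_elim (use assms in \<open>auto simp: blaschke_eq_0_iff\<close>)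
qed

lemma zorder_blaschke:
  assumes lf: "locally_finite \<Lambda>" and z: "z \<in> blaschke_domain \<Lambda> R" and R: "R > 0"
  shows "zorder (blaschke \<Lambda> R) z = (if cmod z < R then int (\<Lambda> z) else 0)"
proof -
  define W where "W = inner_zeros \<Lambda> R"
  have finW: "finite W" unfolding W_def by (rule finite_inner_zeros[OF lf])
  define b where "b = (\<lambda>w u. (1 - u / w) / (1 - cnj w * u / complex_of_real (R\<^sup>2)))"
  define P where "P = (\<lambda>w u. b w u ^ \<Lambda> w)"
  have Beq: "blaschke \<Lambda> R = (\<lambda>u. u ^ \<Lambda> 0 * (\<Prod>w\<in>W. P w u))"
    by (simp add: blaschke_def P_def b_def W_def fun_eq_iff)
  have ana_b: "b w analytic_on {z}" if "w \<in> W" for w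
    using that z unfolding b_def W_def blaschke_domain_def
    by (intro analytic_intros) auto
  have ana: "P w analytic_on {z}" if "w \<in> W" for w
    unfolding P_def by (intro analytic_intros ana_b that)
  have ev: "eventually (\<lambda>u. u ^ \<Lambda> 0 * (\<Prod>w\<in>W. P w u) \<noteq> 0) (at z)"
    using blaschke_eventually_nonzero[OF lf z R] by (simp add: Beq)
  then have ev': "eventually (\<lambda>u. (\<Prod>w\<in>W. P w u) \<noteq> 0) (at z)"
    by eventually_elim auto
  have zP: "zorder (P w) z = (if z = w then int (\<Lambda> w) else 0)" if w: "w \<in> W" for w
  proof -
    have d: "1 - cnj w * z / complex_of_real (R\<^sup>2) \<noteq> 0" and w0: "w \<noteq> 0" and \<Lambda>w: "\<Lambda> w > 0"
      using w z by (auto simp: W_def blaschke_domain_def)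
    show ?thesis
    proof (cases "z = w")
      case False
      then have "P w z \<noteq> 0" unfolding P_def b_def using d w0 by (intro power_not_zero) (simp only: divide_eq_0_iff, simp)
      then show ?thesis using zorder_eq_0I[OF ana[OF w]] False by simp
    next
      case True
      have "zorder (P w) z = int (\<Lambda> w)"
      proof (rule zorder_eqI)
        show "open (blaschke_domain \<Lambda> R)" by (rule open_blaschke_domain[OF lf])
        show "z \<in> blaschke_domain \<Lambda> R" by (rule z)
        show "(\<lambda>u. (- 1 / (w * (1 - cnj w * u / complex_of_real (R\<^sup>2)))) ^ \<Lambda> w)
            holomorphic_on blaschke_domain \<Lambda> R"
          using w w0 by (intro holomorphic_intros) (auto simp: blaschke_domain_def W_def)
        show "(- 1 / (w * (1 - cnj w * z / complex_of_real (R\<^sup>2)))) ^ \<Lambda> w \<noteq> 0"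
          using d w0 by (intro power_not_zero) (simp only: divide_eq_0_iff mult_eq_0_iff, simp)
        fix u assume "u \<in> blaschke_domain \<Lambda> R"
        then have "1 - cnj w * u / complex_of_real (R\<^sup>2) \<noteq> 0"
          using w unfolding blaschke_domain_def W_def by blast
        then have "b w u = - 1 / (w * (1 - cnj w * u / complex_of_real (R\<^sup>2))) * (u - z)"
          using w0 unfolding b_def True[symmetric] by (simp add: divide_simps)
        then show "P w u = (- 1 / (w * (1 - cnj w * u / complex_of_real (R\<^sup>2)))) ^ \<Lambda> w
            * (u - z) powi int (\<Lambda> w)"
          by (simp only: P_def power_mult_distrib power_int_of_nat)
      qed
      then show ?thesis using True by simp
    qed
  qed
  have z0: "zorder (\<lambda>u. u ^ \<Lambda> 0) z = (if z = 0 then int (\<Lambda> 0) else 0)"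
  proof (cases "z = 0")
    case True
    have "zorder (\<lambda>u. u ^ \<Lambda> 0) z = int (\<Lambda> 0)"
      by (rule zorder_eqI[where S = UNIV and g = "\<lambda>_. 1"]) (auto simp: True)
    then show ?thesis using True by simp
  next
    case False
    have "(\<lambda>u::complex. u ^ \<Lambda> 0) analytic_on {z}" by (intro analytic_intros)
    then show ?thesis using False zorder_eq_0I by simp
  qed
  have "zorder (blaschke \<Lambda> R) z = zorder (\<lambda>u. u ^ \<Lambda> 0) z + zorder (\<lambda>u. \<Prod>w\<in>W. P w u) z"
    unfolding Beq by (intro zorder_times_analytic ev analytic_intros ana)
  also have "zorder (\<lambda>u. \<Prod>w\<in>W. P w u) z = (\<Sum>w\<in>W. zorder (P w) z)"
    by (intro zorder_prod_analytic ana ev')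
  also have "\<dots> = (\<Sum>w\<in>W. if z = w then int (\<Lambda> w) else 0)" by (intro sum.cong zP refl)
  also have "\<dots> = (if z \<in> W then int (\<Lambda> z) else 0)" using finW by simp
  finally show ?thesis unfolding z0 using R by (auto simp: W_def)
qed

text \<open>This is where Jensen's sum comes from: on the circle the factor of a zero \<open>w\<close> has modulus exactly
  \<open>R / \<bar>w\<bar>\<close>. Zeros on the circle itself are in the sum but not in the product; they contribute
  \<open>ln 1 = 0\<close>.\<close>

lemma norm_blaschke_sphere:
  assumes lf: "locally_finite \<Lambda>" and R: "R > 0" and z: "cmod z = R"
  shows "cmod (blaschke \<Lambda> R z) = exp (jensen_sum \<Lambda> R)"
proof -
  define W where "W = inner_zeros \<Lambda> R"
  define V where "V = {w. 0 < cmod w \<and> cmod w \<le> R \<and> 0 < \<Lambda> w}"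
  have finV: "finite V"
    using lf unfolding locally_finite_def V_def by (elim allE[of _ R], elim rev_finite_subset) auto
  have fac: "cmod ((1 - z / w) / (1 - cnj w * z / complex_of_real (R\<^sup>2))) = R / cmod w"
    if w: "w \<in> W" for w
  proof -
    have w0: "w \<noteq> 0" and wR: "cmod w < R" using w by (auto simp: W_def)
    have zz: "complex_of_real (R\<^sup>2) = cnj z * z"
      using z by (metis complex_norm_square mult.commute)
    have z0: "z \<noteq> 0" using z R by auto
    have "1 - cnj w * z / complex_of_real (R\<^sup>2) = cnj (z - w) / cnj z"
      unfolding zz using z0 by (simp add: divide_simps)
    then have d: "cmod (1 - cnj w * z / complex_of_real (R\<^sup>2)) = cmod (z - w) / R"
      by (metis complex_mod_cnj norm_divide z)
    have "1 - z / w = - ((z - w) / w)" using w0 by (simp add: divide_simps)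
    then have n: "cmod (1 - z / w) = cmod (z - w) / cmod w"
      by (simp add: norm_divide)
    have "cmod (z - w) \<noteq> 0" using wR z by auto
    then show ?thesis unfolding norm_divide d n using R by simp
  qed
  have "cmod (blaschke \<Lambda> R z) = R ^ \<Lambda> 0 * (\<Prod>w\<in>W. (R / cmod w) ^ \<Lambda> w)"
    unfolding blaschke_def norm_mult norm_power z prod_norm[symmetric] W_def[symmetric]
    by (simp only: fac cong: prod.cong)
  also have "R ^ \<Lambda> 0 = exp (real (\<Lambda> 0) * ln R)"
    using R by (simp add: exp_of_nat_mult)
  also have "(\<Prod>w\<in>W. (R / cmod w) ^ \<Lambda> w) = exp (\<Sum>w\<in>W. real (\<Lambda> w) * ln (R / cmod w))"
  proof -
    have "finite W" unfolding W_def by (rule finite_inner_zeros[OF lf])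
    moreover have "(R / cmod w) ^ \<Lambda> w = exp (real (\<Lambda> w) * ln (R / cmod w))" if "w \<in> W" for w
      using R that by (auto simp: exp_of_nat_mult W_def)
    ultimately show ?thesis by (simp add: exp_sum)
  qed
  also have "(\<Sum>w\<in>W. real (\<Lambda> w) * ln (R / cmod w)) = (\<Sum>w\<in>V. real (\<Lambda> w) * ln (R / cmod w))"
    using R by (intro sum.mono_neutral_left finV) (auto simp: W_def V_def)
  finally show ?thesis by (simp add: jensen_sum_def V_def exp_add)
qed

section \<open>Functions with a prescribed divisor\<close>

text \<open>The quotient has only removable singularities, because its order is nowhere negative.\<close>

lemma holomorphic_quotient_of_zorder_le:
  assumes S: "open S" and f: "f holomorphic_on S" and g: "g holomorphic_on S"
    and fnz: "\<And>z. z \<in> S \<Longrightarrow> eventually (\<lambda>u. f u \<noteq> 0) (at z)"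
    and gnz: "\<And>z. z \<in> S \<Longrightarrow> eventually (\<lambda>u. g u \<noteq> 0) (at z)"
    and le: "\<And>z. z \<in> S \<Longrightarrow> zorder g z \<le> zorder f z"
  obtains q where "q holomorphic_on S" "\<And>z. z \<in> S \<Longrightarrow> f z = g z * q z"
    "\<And>z. z \<in> S \<Longrightarrow> zorder f z = zorder g z \<Longrightarrow> q z \<noteq> 0"
proof -
  define q where "q = remove_sings (\<lambda>u. f u / g u)"
  have fa: "f analytic_on {z}" and ga: "g analytic_on {z}" if "z \<in> S" for z
    using holomorphic_on_imp_analytic_at[OF f S that] holomorphic_on_imp_analytic_at[OF g S that] .
  have mer: "(\<lambda>u. f u / g u) meromorphic_on {z}" if "z \<in> S" for z
    by (intro meromorphic_intros analytic_on_imp_meromorphic_on fa ga that)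
  have qa: "q analytic_on {z}" if z: "z \<in> S" for z
  proof -
    have fr: "\<exists>\<^sub>F u in at z. f u \<noteq> 0" "\<exists>\<^sub>F u in at z. g u \<noteq> 0"
      by (auto intro!: eventually_frequently fnz gnz z)
    have iso: "isolated_singularity_at (\<lambda>u. f u / g u) z" "not_essential (\<lambda>u. f u / g u) z"
      using mer[OF z] by (auto simp: meromorphic_at_iff)
    have "zorder (\<lambda>u. f u / g u) z = zorder f z - zorder g z"
      by (intro zorder_divide analytic_on_imp_meromorphic_on fa ga z fr)
    then have "zorder (\<lambda>u. f u / g u) z \<ge> 0" using le[OF z] by simp
    moreover have "\<exists>\<^sub>F u in at z. f u / g u \<noteq> 0"
      using eventually_conj[OF fnz[OF z] gnz[OF z]]
      by (intro eventually_frequently) (auto elim: eventually_mono)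
    ultimately have "\<not> is_pole (\<lambda>u. f u / g u) z"
      using isolated_pole_imp_neg_zorder iso by fastforce
    then obtain c where "(\<lambda>u. f u / g u) \<midarrow>z\<rightarrow> c"
      using iso(2) by (auto simp: not_essential_def)
    then show ?thesis unfolding q_def by (intro remove_sings_analytic_at iso)
  qed
  have hol: "q holomorphic_on S"
    using qa by (meson analytic_imp_holomorphic analytic_on_analytic_at)
  have fgq: "f z = g z * q z" if z: "z \<in> S" for z
  proof -
    have "eventually (\<lambda>u. q u = f u / g u) (at z)"
      unfolding q_def using mer[OF z] by (intro eventually_remove_sings_eq_at) (auto simp: meromorphic_at_iff)
    then have ev: "eventually (\<lambda>u. g u * q u = f u) (at z)"
      using gnz[OF z] by eventually_elim simp
    have "((\<lambda>u. g u * q u) \<longlongrightarrow> g z * q z) (at z)"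
      using analytic_at_imp_isCont[OF ga[OF z]] analytic_at_imp_isCont[OF qa[OF z]]
      by (intro tendsto_intros) (auto simp: isCont_def)
    then have "(f \<longlongrightarrow> g z * q z) (at z)"
      using ev by (rule Lim_transform_eventually)
    moreover have "(f \<longlongrightarrow> f z) (at z)" using analytic_at_imp_isCont[OF fa[OF z]] by (simp add: isCont_def)
    ultimately show ?thesis by (metis LIM_unique)
  qed
  have nz: "q z \<noteq> 0" if z: "z \<in> S" and eq: "zorder f z = zorder g z" for z
  proof -
    have in_S: "eventually (\<lambda>u. u \<in> S) (at z)" by (intro eventually_at_in_open' S z)
    have ev: "eventually (\<lambda>u. g u * q u \<noteq> 0) (at z)"
      using fnz[OF z] in_S by eventually_elim (use fgq in auto)
    have "zorder f z = zorder (\<lambda>u. g u * q u) z"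
      using in_S by (intro zorder_cong) (auto elim!: eventually_mono simp: fgq)
    also have "\<dots> = zorder g z + zorder q z"
      by (intro zorder_times_analytic ga qa z ev)
    finally have "zorder q z = 0" using eq by simp
    then show ?thesis
      using ev by (subst (asm) zorder_eq_0_iff)
        (auto intro!: qa z eventually_frequently elim!: eventually_mono)
  qed
  from hol fgq nz show ?thesis by (rule that)
qed

text \<open>On the disc of radius \<open>r\<close>, the function \<open>h\<close> has zeros exactly \<open>\<Lambda>\<close> and leading coefficient
  \<open>1\<close>. Expressing this through a zero-free cofactor of the Blaschke product, instead of through
  orders, is what passes easily to limits and to smaller discs.\<close>

definition disc_divisor :: "(complex \<Rightarrow> nat) \<Rightarrow> real \<Rightarrow> (complex \<Rightarrow> complex) \<Rightarrow> bool" where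
  "disc_divisor \<Lambda> r h \<longleftrightarrow> (\<exists>q. q holomorphic_on ball 0 r \<and> q 0 = 1 \<and>
     (\<forall>z\<in>ball 0 r. q z \<noteq> 0 \<and> h z = blaschke \<Lambda> r z * q z))"

lemma disc_divisor_holomorphic:
  assumes "disc_divisor \<Lambda> r h"
  shows "h holomorphic_on ball 0 r"
proof -
  obtain q where "q holomorphic_on ball 0 r" "\<forall>z\<in>ball 0 r. h z = blaschke \<Lambda> r z * q z"
    using assms by (auto simp: disc_divisor_def)
  moreover have "(\<lambda>z. blaschke \<Lambda> r z * q z) holomorphic_on ball 0 r"
    by (intro holomorphic_intros ball_subset_blaschke_domain calculation) auto
  ultimately show ?thesis by (subst holomorphic_cong[OF refl, of _ _ "\<lambda>z. blaschke \<Lambda> r z * q z"]) auto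
qed

text \<open>The radius of the Blaschke product may exceed that of the disc: the quotient \<open>D\<close> of the products
  of radii \<open>R\<close> and \<open>r\<close> is zero-free on the smaller disc and equals \<open>1\<close> at the origin.\<close>

lemma disc_divisorI:
  assumes lf: "locally_finite \<Lambda>" and r: "0 < r" "r \<le> R"
    and q: "q holomorphic_on ball 0 r" "q 0 = 1"
      "\<And>z. z \<in> ball 0 r \<Longrightarrow> q z \<noteq> 0" "\<And>z. z \<in> ball 0 r \<Longrightarrow> h z = blaschke \<Lambda> R z * q z"
  shows "disc_divisor \<Lambda> r h"
proof -
  define W where "W = inner_zeros \<Lambda> R"
  define V where "V = inner_zeros \<Lambda> r"
  have finW: "finite W" unfolding W_def by (rule finite_inner_zeros[OF lf])
  have VW: "V \<subseteq> W" using r by (auto simp: W_def V_def)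
  define d where "d = (\<lambda>\<rho> w z. 1 - cnj w * z / complex_of_real (\<rho>\<^sup>2))"
  define D where "D = (\<lambda>z. (\<Prod>w\<in>V. (d r w z / d R w z) ^ \<Lambda> w) *
                            (\<Prod>w\<in>W - V. ((1 - z / w) / d R w z) ^ \<Lambda> w))"
  have dR: "d R w z \<noteq> 0" if "w \<in> W" "z \<in> ball 0 r" for w z
    unfolding d_def by (rule blaschke_denominator_nonzero) (use that r in \<open>auto simp: W_def\<close>)
  have dr: "d r w z \<noteq> 0" if "w \<in> V" "z \<in> ball 0 r" for w z
    unfolding d_def by (rule blaschke_denominator_nonzero) (use that r in \<open>auto simp: V_def\<close>)
  have d_hol: "d \<rho> w holomorphic_on A" for \<rho> w A
    unfolding d_def by (cases "\<rho> = 0") (auto intro!: holomorphic_intros)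
  have holD: "D holomorphic_on ball 0 r"
    unfolding D_def using VW dR
    by (intro holomorphic_intros d_hol) (auto simp: W_def)
  have wz: "1 - z / w \<noteq> 0" if "w \<in> W - V" "z \<in> ball 0 r" for w z
    using that by (auto simp: W_def V_def)
  have D0: "D z \<noteq> 0" if z: "z \<in> ball 0 r" for z
    unfolding D_def using finW finite_subset[OF VW finW] VW dR[OF _ z] dr[OF _ z] wz[OF _ z]
    by auto
  have BD: "blaschke \<Lambda> R z = blaschke \<Lambda> r z * D z" if z: "z \<in> ball 0 r" for z
  proof -
    have "(\<Prod>w\<in>W. ((1 - z / w) / d R w z) ^ \<Lambda> w) =
        (\<Prod>w\<in>V. ((1 - z / w) / d R w z) ^ \<Lambda> w) * (\<Prod>w\<in>W - V. ((1 - z / w) / d R w z) ^ \<Lambda> w)"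
      by (subst prod.subset_diff[OF VW finW]) (simp add: mult.commute)
    also have "(\<Prod>w\<in>V. ((1 - z / w) / d R w z) ^ \<Lambda> w) =
        (\<Prod>w\<in>V. ((1 - z / w) / d r w z) ^ \<Lambda> w * (d r w z / d R w z) ^ \<Lambda> w)"
      using dr[OF _ z] by (intro prod.cong) (auto simp flip: power_mult_distrib)
    also have "\<dots> = (\<Prod>w\<in>V. ((1 - z / w) / d r w z) ^ \<Lambda> w) * (\<Prod>w\<in>V. (d r w z / d R w z) ^ \<Lambda> w)"
      by (rule prod.distrib)
    finally show ?thesis
      by (simp add: blaschke_def D_def W_def V_def d_def mult.assoc)
  qed
  have D00: "D 0 = 1" by (simp add: D_def d_def)
  show ?thesis unfolding disc_divisor_def
  proof (intro exI[of _ "\<lambda>z. D z * q z"] conjI ballI)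
    show "(\<lambda>z. D z * q z) holomorphic_on ball 0 r"
      by (intro holomorphic_intros holD q)
    show "D 0 * q 0 = 1" by (simp add: q(2) D00)
    fix z assume z: "z \<in> ball (0::complex) r"
    show "D z * q z \<noteq> 0" using q(3)[OF z] D0[OF z] by simp
    show "h z = blaschke \<Lambda> r z * (D z * q z)" using q(4)[OF z] BD[OF z] by simp
  qed
qed

lemma disc_divisor_mono:
  assumes lf: "locally_finite \<Lambda>" and r: "0 < r" "r \<le> R" and h: "disc_divisor \<Lambda> R h"
  shows "disc_divisor \<Lambda> r h"
proof -
  obtain q where "q holomorphic_on ball 0 R" "q 0 = 1"
      "\<And>z. z \<in> ball 0 R \<Longrightarrow> q z \<noteq> 0 \<and> h z = blaschke \<Lambda> R z * q z"
    using h by (auto simp: disc_divisor_def)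
  moreover have "ball 0 r \<subseteq> ball (0::complex) R" using r by auto
  ultimately show ?thesis
    by (intro disc_divisorI[OF lf r, of q]) (auto intro: holomorphic_on_subset)
qed

lemma disc_divisor_zorder:
  assumes lf: "locally_finite \<Lambda>" and h: "disc_divisor \<Lambda> r h" and z: "z \<in> ball 0 r"
  shows "zorder h z = int (\<Lambda> z)"
proof -
  obtain q where q: "q holomorphic_on ball 0 r"
      "\<And>z. z \<in> ball 0 r \<Longrightarrow> q z \<noteq> 0 \<and> h z = blaschke \<Lambda> r z * q z"
    using h by (auto simp: disc_divisor_def)
  have r: "r > 0" using z le_less_trans[OF norm_ge_zero] by auto
  have qa: "q analytic_on {z}" by (rule holomorphic_on_imp_analytic_at[OF q(1) _ z]) auto
  have zd: "z \<in> blaschke_domain \<Lambda> r" using ball_subset_blaschke_domain[of r r \<Lambda>] z by auto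
  have Ba: "blaschke \<Lambda> r analytic_on {z}"
    by (rule holomorphic_on_imp_analytic_at[OF _ open_blaschke_domain[OF lf] zd])
       (intro holomorphic_intros order_refl)
  have in_ball: "eventually (\<lambda>u. u \<in> ball 0 r) (at z)" by (intro eventually_at_in_open' z) auto
  have "zorder h z = zorder (\<lambda>u. blaschke \<Lambda> r u * q u) z"
    using in_ball by (intro zorder_cong) (auto elim!: eventually_mono simp: q)
  also have "\<dots> = zorder (blaschke \<Lambda> r) z + zorder q z"
    using blaschke_eventually_nonzero[OF lf zd r] in_ball
    by (intro zorder_times_analytic Ba qa, eventually_elim) (use q in auto)
  also have "zorder q z = 0" using q(2)[OF z] by (intro zorder_eq_0I qa) auto
  finally show ?thesis using zorder_blaschke[OF lf zd r] z by simp
qed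

text \<open>The factors of the nonzero zeros are normalized to be \<open>1\<close> at the origin, so \<open>h\<close> is
  \<open>z ^ \<Lambda> 0\<close> times a function whose value at \<open>0\<close> is that of \<open>q\<close>.\<close>

lemma blaschke_leading_coeff:
  assumes lf: "locally_finite \<Lambda>" and r: "r > 0" and q: "q holomorphic_on ball 0 r"
    and h: "\<And>z. z \<in> ball 0 r \<Longrightarrow> h z = blaschke \<Lambda> r z * q z"
  shows "fps_nth (fps_expansion h 0) (\<Lambda> 0) = q 0"
proof -
  define v where "v = (\<lambda>z. (\<Prod>w\<in>inner_zeros \<Lambda> r.
      ((1 - z / w) / (1 - cnj w * z / complex_of_real (r\<^sup>2))) ^ \<Lambda> w) * q z)"
  have "v holomorphic_on ball 0 r"
    unfolding v_def using ball_subset_blaschke_domain[of r r \<Lambda>]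
    by (intro holomorphic_intros q) (auto simp: blaschke_domain_def)
  then have "v analytic_on {0}" using r by (intro holomorphic_on_imp_analytic_at[of _ "ball 0 r"]) auto
  then have V: "v has_fps_expansion fps_expansion v 0"
    by (intro analytic_at_imp_has_fps_expansion_0)
  have "(\<lambda>z. z ^ \<Lambda> 0 * v z) has_fps_expansion fps_X ^ \<Lambda> 0 * fps_expansion v 0"
    by (intro fps_expansion_intros V)
  moreover have "eventually (\<lambda>z. h z = z ^ \<Lambda> 0 * v z) (nhds 0)"
    using eventually_nhds_in_open[of "ball 0 r" "0 :: complex"] r
    by (auto elim!: eventually_mono simp: h blaschke_def v_def mult.assoc)
  ultimately have "h has_fps_expansion fps_X ^ \<Lambda> 0 * fps_expansion v 0"
    by (subst has_fps_expansion_cong[OF _ refl])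
  then have "fps_expansion h 0 = fps_X ^ \<Lambda> 0 * fps_expansion v 0" by (rule fps_expansion_eqI)
  then have "fps_nth (fps_expansion h 0) (\<Lambda> 0) = v 0"
    by (simp add: fps_X_power_mult_nth fps_expansion_def)
  then show ?thesis by (simp add: v_def)
qed

lemma disc_divisors_imp_has_zeros:
  assumes lf: "locally_finite \<Lambda>" and h: "\<And>r. r > 0 \<Longrightarrow> disc_divisor \<Lambda> r h"
  shows "has_zeros h \<Lambda>" "fps_nth (fps_expansion h 0) (\<Lambda> 0) = 1"
proof -
  show co: "fps_nth (fps_expansion h 0) (\<Lambda> 0) = 1"
  proof -
    obtain q where q: "q holomorphic_on ball 0 1" "q 0 = 1"
        "\<And>z. z \<in> ball 0 1 \<Longrightarrow> q z \<noteq> 0 \<and> h z = blaschke \<Lambda> 1 z * q z"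
      using h[of 1] by (auto simp: disc_divisor_def)
    show ?thesis using blaschke_leading_coeff[OF lf _ q(1), of h] q by auto
  qed
  have hz: "h holomorphic_on ball 0 (cmod z + 1)" for z
    by (intro disc_divisor_holomorphic[of \<Lambda>] h) (simp add: add_nonneg_pos)
  have "h field_differentiable (at z)" for z
    by (rule holomorphic_on_imp_differentiable_at[OF hz[of z]]) auto
  then have hol: "h holomorphic_on UNIV"
    by (auto simp: holomorphic_on_def)
  have "\<exists>z. h z \<noteq> 0"
  proof (rule ccontr)
    assume "\<not> ?thesis"
    then have "h = (\<lambda>_. 0)" by auto
    then have "fps_expansion h 0 = 0" by (intro fps_expansion_eqI) (auto intro: fps_expansion_intros)
    then show False using co by simp
  qed
  moreover have "zorder h z = int (\<Lambda> z)" for z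
    by (rule disc_divisor_zorder[OF lf, of "cmod z + 1"]) (auto intro!: h simp: add_nonneg_pos)
  ultimately show "has_zeros h \<Lambda>" by (simp add: has_zeros_def hol)
qed

lemma has_zeros_eventually_nonzero:
  assumes "has_zeros f \<Lambda>"
  shows "eventually (\<lambda>u. f u \<noteq> 0) (at z)"
proof -
  obtain b where "f b \<noteq> 0" "f holomorphic_on UNIV" using assms by (auto simp: has_zeros_def)
  then show ?thesis using non_zero_neighbour_alt[of f UNIV z b] by (auto elim: eventually_mono)
qed

text \<open>Outside the disc the product is zero-free while \<open>f\<close> need not be, so on the whole
  domain the orders are only compared by \<open>\<le>\<close>, and the cofactor may vanish off the disc.\<close>

lemma has_zeros_blaschke_quotient:
  assumes lf: "locally_finite \<Lambda>" and f: "has_zeros f \<Lambda>" and R: "R > 0"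
  obtains q where "q holomorphic_on blaschke_domain \<Lambda> R"
    "\<And>z. z \<in> blaschke_domain \<Lambda> R \<Longrightarrow> f z = blaschke \<Lambda> R z * q z"
    "\<And>z. z \<in> ball 0 R \<Longrightarrow> q z \<noteq> 0" "q 0 = fps_nth (fps_expansion f 0) (\<Lambda> 0)"
proof -
  let ?S = "blaschke_domain \<Lambda> R"
  obtain q where q: "q holomorphic_on ?S" "\<And>z. z \<in> ?S \<Longrightarrow> f z = blaschke \<Lambda> R z * q z"
    "\<And>z. z \<in> ?S \<Longrightarrow> zorder f z = zorder (blaschke \<Lambda> R) z \<Longrightarrow> q z \<noteq> 0"
  proof (rule holomorphic_quotient_of_zorder_le[of ?S f "blaschke \<Lambda> R"])
    show "open ?S" by (rule open_blaschke_domain[OF lf])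
    show "f holomorphic_on ?S" using f by (auto simp: has_zeros_def intro: holomorphic_on_subset)
    show "blaschke \<Lambda> R holomorphic_on ?S" by (intro holomorphic_intros order_refl)
    fix z assume z: "z \<in> ?S"
    show "eventually (\<lambda>u. f u \<noteq> 0) (at z)" by (rule has_zeros_eventually_nonzero[OF f])
    show "eventually (\<lambda>u. blaschke \<Lambda> R u \<noteq> 0) (at z)" by (rule blaschke_eventually_nonzero[OF lf z R])
    show "zorder (blaschke \<Lambda> R) z \<le> zorder f z"
      using zorder_blaschke[OF lf z R] f by (auto simp: has_zeros_def)
  qed blast
  have sub: "ball 0 R \<subseteq> ?S" by (rule ball_subset_blaschke_domain) simp
  show ?thesis
  proof (rule that[OF q(1,2)])
    fix z assume z: "z \<in> ball (0::complex) R"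
    then have "z \<in> ?S" using sub by blast
    with z show "q z \<noteq> 0" using zorder_blaschke[OF lf _ R, of z] f by (intro q(3)) (auto simp: has_zeros_def)
  next
    show "q 0 = fps_nth (fps_expansion f 0) (\<Lambda> 0)"
      using q(2) sub
      by (intro blaschke_leading_coeff[OF lf R, symmetric] holomorphic_on_subset[OF q(1)]) auto
  qed
qed

section \<open>Taylor remainders under a one-sided bound\<close>

text \<open>Schwarz's lemma for \<open>g / (2 A - g)\<close>: the Moebius map \<open>w \<mapsto> w / (2 A - w)\<close> sends the half-plane
  \<open>Re w < A\<close> to the unit disc and fixes the origin.\<close>

lemma Borel_Caratheodory:
  assumes g: "g holomorphic_on ball 0 R" and g0: "g 0 = 0" and A: "A > 0"
    and le: "\<And>z. z \<in> ball 0 R \<Longrightarrow> Re (g z) < A" and z: "z \<in> ball 0 R"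
  shows "cmod (g z) * (R - cmod z) \<le> 2 * A * cmod z"
proof -
  have R: "R > 0" using z le_less_trans[OF norm_ge_zero] by auto
  define h where "h = (\<lambda>u. g (of_real R * u) / (of_real (2 * A) - g (of_real R * u)))"
  have scale: "of_real R * u \<in> ball 0 R" if "u \<in> ball (0::complex) 1" for u
    using that R by (simp add: norm_mult)
  have lt: "cmod (g v) < cmod (of_real (2 * A) - g v)" if v: "v \<in> ball 0 R" for v
  proof -
    have "(cmod (of_real (2 * A) - g v))\<^sup>2 - (cmod (g v))\<^sup>2 = 4 * A * (A - Re (g v))"
      unfolding cmod_power2 by (simp add: power2_eq_square algebra_simps)
    moreover have "4 * A * (A - Re (g v)) > 0" using le[OF v] A by simp
    ultimately have "(cmod (g v))\<^sup>2 < (cmod (of_real (2 * A) - g v))\<^sup>2" by simp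
    then show ?thesis by (rule power2_less_imp_less) simp
  qed
  have den: "of_real (2 * A) - g v \<noteq> 0" if "v \<in> ball 0 R" for v
    using lt[OF that] by (metis norm_ge_zero norm_zero not_le)
  have gs: "(\<lambda>u. g (of_real R * u)) holomorphic_on ball 0 1"
    using holomorphic_on_compose_gen[of "\<lambda>u. of_real R * u" "ball 0 1" g "ball 0 R"] g scale
    by (auto simp: o_def image_subset_iff intro!: holomorphic_intros)
  have holh: "h holomorphic_on ball 0 1"
    unfolding h_def by (intro holomorphic_intros gs den scale)
  have "h 0 = 0" by (simp add: h_def g0)
  moreover have "cmod (h u) < 1" if "cmod u < 1" for u
  proof -
    have "of_real R * u \<in> ball 0 R" using that by (intro scale) simp
    from lt[OF this] show ?thesis
      unfolding h_def norm_divide by (intro divide_less_eq_1_pos[THEN iffD2]) (auto intro: le_less_trans[OF norm_ge_zero])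
  qed
  moreover define u where "u = z / of_real R"
  have u1: "cmod u < 1" using z R by (simp add: u_def norm_divide)
  ultimately have "cmod (h u) \<le> cmod u" by (intro Schwarz_Lemma(1)[OF holh])
  moreover have Ru: "of_real R * u = z" using R by (simp add: u_def)
  ultimately have "cmod (g z) \<le> cmod u * cmod (of_real (2 * A) - g z)"
    using lt[OF z] le_less_trans[OF norm_ge_zero lt[OF z]]
    by (simp add: h_def norm_divide pos_divide_le_eq)
  also have "\<dots> \<le> cmod u * (2 * A + cmod (g z))"
    using norm_triangle_ineq4[of "of_real (2 * A)" "g z"] A by (intro mult_left_mono) auto
  finally have "R * cmod (g z) \<le> R * (cmod u * (2 * A + cmod (g z)))"
    using R by (intro mult_left_mono) auto
  also have "R * (cmod u * (2 * A + cmod (g z))) = cmod z * (2 * A + cmod (g z))"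
    using R by (simp add: u_def norm_divide)
  finally show ?thesis by (simp add: algebra_simps)
qed

text \<open>Cauchy's inequality on the circle of radius \<open>2 R / 3\<close>, where Borel--Caratheodory gives
  \<open>\<bar>g\<bar> \<le> 4 A\<close>. Any radius strictly between \<open>R / 2\<close> and \<open>R\<close> would do: it has to exceed \<open>R / 2\<close> so that
  the resulting series still converges geometrically on \<open>\<bar>z\<bar> \<le> R / 2\<close>.\<close>

lemma Taylor_coeff_bound:
  assumes g: "g holomorphic_on ball 0 R" and g0: "g 0 = 0" and A: "A > 0" and R: "R > 0"
    and le: "\<And>z. z \<in> ball 0 R \<Longrightarrow> Re (g z) < A"
  shows "cmod ((deriv ^^ n) g 0 / fact n) \<le> 4 * A / (2 * R / 3) ^ n"
proof -
  have sub: "cball 0 (2 * R / 3) \<subseteq> ball (0::complex) R" using R by auto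
  have "cmod ((deriv ^^ n) g 0) \<le> fact n * (4 * A) / (2 * R / 3) ^ n"
  proof (rule Cauchy_inequality)
    show "g holomorphic_on ball 0 (2 * R / 3)"
      by (rule holomorphic_on_subset[OF g subset_trans[OF ball_subset_cball sub]])
    show "continuous_on (cball 0 (2 * R / 3)) g"
      by (rule continuous_on_subset[OF holomorphic_on_imp_continuous_on[OF g] sub])
    fix x :: complex assume "cmod (0 - x) = 2 * R / 3"
    then have x: "cmod x = 2 * R / 3" by simp
    then have "cmod (g x) * (R - cmod x) \<le> 2 * A * cmod x"
      using R by (intro Borel_Caratheodory[OF g g0 A le]) auto
    then have "R * cmod (g x) \<le> R * (4 * A)" unfolding x by (simp add: field_simps)
    then show "cmod (g x) \<le> 4 * A" using R by simp
  qed (use R in auto)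
  then show ?thesis by (simp add: norm_divide field_simps)
qed

text \<open>With \<open>t = 3 \<bar>z\<bar> / (2 R) \<le> 3 / 4\<close> the remainder is dominated by \<open>4 A t\<^bsup>p+1\<^esup> / (1 - t)\<close>.\<close>

lemma Taylor_remainder_bound:
  assumes g: "g holomorphic_on ball 0 R" and g0: "g 0 = 0" and A: "A > 0" and R: "R > 0"
    and le: "\<And>z. z \<in> ball 0 R \<Longrightarrow> Re (g z) < A" and z: "2 * cmod z \<le> R"
  shows "cmod (g z - (\<Sum>j=1..p. (deriv ^^ j) g 0 / fact j * z ^ j))
      \<le> 16 * A * (3 / 2) ^ (p + 1) * (cmod z / R) ^ (p + 1)"
proof -
  define a where "a = (\<lambda>j. (deriv ^^ j) g 0 / fact j)"
  define t where "t = 3 / 2 * (cmod z / R)"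
  have t: "0 \<le> t" "t \<le> 3 / 4" using z R by (auto simp: t_def field_simps)
  have bnd: "cmod (a j * z ^ j) \<le> 4 * A * t ^ j" for j
  proof -
    have "cmod (a j * z ^ j) \<le> 4 * A / (2 * R / 3) ^ j * cmod z ^ j"
      unfolding norm_mult norm_power a_def
      by (intro mult_right_mono Taylor_coeff_bound[OF g g0 A R le]) auto
    also have "\<dots> = 4 * A * (cmod z / (2 * R / 3)) ^ j" by (simp add: power_divide)
    also have "cmod z / (2 * R / 3) = t" using R by (simp add: t_def)
    finally show ?thesis .
  qed
  have zb: "z \<in> ball 0 R" using z R norm_ge_zero[of z] by (simp del: norm_ge_zero)
  have "(\<lambda>n. a n * z ^ n) sums g z"
    using holomorphic_power_series[OF g zb] by (simp add: a_def)
  then have "(\<lambda>n. a (n + (p + 1)) * z ^ (n + (p + 1))) sums (g z - (\<Sum>n<p + 1. a n * z ^ n))"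
    by (rule sums_split_initial_segment)
  also have "(\<Sum>n<p + 1. a n * z ^ n) = a 0 + (\<Sum>j=1..p. a j * z ^ j)"
    by (simp add: lessThan_Suc_atMost atMost_atLeast0 sum.atLeast_Suc_atMost)
  also have "a 0 = 0" by (simp add: a_def g0)
  finally have sums: "(\<lambda>n. a (n + (p + 1)) * z ^ (n + (p + 1))) sums (g z - (\<Sum>j=1..p. a j * z ^ j))" by simp
  have geo: "(\<lambda>n. 4 * A * t ^ (p + 1) * t ^ n) sums (4 * A * t ^ (p + 1) * (1 / (1 - t)))"
    using t by (intro sums_mult geometric_sums) auto
  have "cmod (suminf (\<lambda>n. a (n + (p + 1)) * z ^ (n + (p + 1)))) \<le> suminf (\<lambda>n. 4 * A * t ^ (p + 1) * t ^ n)"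
  proof (intro norm_suminf_le sums_summable[OF geo])
    fix n
    have "4 * A * t ^ (p + 1) * t ^ n = 4 * A * t ^ (n + (p + 1))" by (simp add: power_add)
    then show "cmod (a (n + (p + 1)) * z ^ (n + (p + 1))) \<le> 4 * A * t ^ (p + 1) * t ^ n"
      using bnd[of "n + (p + 1)"] by (simp only:)
  qed
  then have "cmod (g z - (\<Sum>j=1..p. a j * z ^ j)) \<le> 4 * A * t ^ (p + 1) * (1 / (1 - t))"
    using sums_unique[OF sums] sums_unique[OF geo] by simp
  also have "\<dots> \<le> 4 * A * t ^ (p + 1) * 4"
    using t A by (intro mult_left_mono) (auto simp: field_simps)
  also have "\<dots> = 16 * A * (3 / 2) ^ (p + 1) * (cmod z / R) ^ (p + 1)"
    by (simp only: t_def power_mult_distrib)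
  finally show ?thesis by (simp add: a_def)
qed

section \<open>Approximating a normalized function by competitors\<close>

lemma gauss_integrand_measurable:
  assumes "continuous_on (ball 0 r) h"
  shows "(\<lambda>z. ennreal ((cmod (h z))\<^sup>2 * exp (- (cmod z)\<^sup>2)) * indicator (ball 0 r) z) \<in> borel_measurable lborel"
proof -
  have "(\<lambda>z. indicator (ball 0 r) z *\<^sub>R ((cmod (h z))\<^sup>2 * exp (- (cmod z)\<^sup>2))) \<in> borel_measurable borel"
    by (intro borel_measurable_continuous_on_indicator continuous_intros assms) auto
  then have "(\<lambda>z. ennreal (indicator (ball 0 r) z *\<^sub>R ((cmod (h z))\<^sup>2 * exp (- (cmod z)\<^sup>2)))) \<in> borel_measurable borel"
    by measurable
  then show ?thesis
    by (simp add: ennreal_mult'' ennreal_indicator mult.commute)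
qed

lemma gauss_integrand_measurable_UNIV:
  assumes "continuous_on UNIV h"
  shows "(\<lambda>z. ennreal ((cmod (h z))\<^sup>2 * exp (- (cmod z)\<^sup>2))) \<in> borel_measurable lborel"
proof -
  have "(\<lambda>z. (cmod (h z))\<^sup>2 * exp (- (cmod z)\<^sup>2)) \<in> borel_measurable borel"
    by (intro borel_measurable_continuous_onI continuous_intros assms)
  then show ?thesis by measurable
qed

lemma fock_growth:
  assumes "f \<in> fock_space"
  obtains C where "C \<ge> 0" "\<And>z. cmod (f z) \<le> exp (C + (cmod z)\<^sup>2 / 2)"
proof -
  have hol: "f holomorphic_on UNIV" and fin: "gauss_normsq UNIV f < \<infinity>"
    using assms by (auto simp: fock_space_def)
  obtain M where M: "M \<ge> 0" "gauss_normsq UNIV f = ennreal M"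
    using fin by (cases "gauss_normsq UNIV f") auto
  define K where "K = 128 * exp 1 * M"
  \<comment> \<open>\<open>1 + K\<close> instead of \<open>sqrt K\<close> avoids the logarithm of zero and makes \<open>C\<close> nonnegative\<close>
  define C where "C = ln (1 + K)"
  have K: "K \<ge> 0" using M by (simp add: K_def)
  have C: "C \<ge> 0" using K by (simp add: C_def)
  have "cmod (f z) \<le> exp (C + (cmod z)\<^sup>2 / 2)" for z
  proof (rule power2_le_imp_le)
    have "(cmod (f z))\<^sup>2 \<le> 128 * exp 1 / 1\<^sup>2 * M * exp ((cmod z)\<^sup>2)"
      by (rule gauss_pointwise_bound[of f z 1 UNIV]) (use M hol in \<open>auto intro: holomorphic_on_subset\<close>)
    also have "\<dots> = K * exp ((cmod z)\<^sup>2)" by (simp add: K_def)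
    also have "\<dots> \<le> (1 + K)\<^sup>2 * exp ((cmod z)\<^sup>2)"
      using K by (intro mult_right_mono) (auto simp: power2_eq_square algebra_simps)
    also have "(1 + K)\<^sup>2 = exp (2 * C)" using K by (simp add: C_def exp_double)
    also have "exp (2 * C) * exp ((cmod z)\<^sup>2) = (exp (C + (cmod z)\<^sup>2 / 2))\<^sup>2"
      by (simp add: exp_double[symmetric] exp_add[symmetric] algebra_simps)
    finally show "(cmod (f z))\<^sup>2 \<le> (exp (C + (cmod z)\<^sup>2 / 2))\<^sup>2" .
  qed simp
  with C show ?thesis by (rule that)
qed

text \<open>The maximum principle on the closed disc: on the circle \<open>\<bar>z\<bar> = R\<close> the cofactor \<open>f / B\<close> has modulus
  at most \<open>exp (C + R\<^sup>2 / 2) / exp (J(R))\<close>. The constant \<open>C\<close> depends on \<open>f\<close> but not on \<open>R\<close>.\<close>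

lemma normalized_fock_factorization:
  assumes lf: "locally_finite \<Lambda>" and f: "f \<in> normalized_fock \<Lambda>"
  obtains C where "C \<ge> 0"
    "\<And>R. R > 0 \<Longrightarrow> \<exists>g. g holomorphic_on ball 0 R \<and> g 0 = 0 \<and>
       (\<forall>z\<in>ball 0 R. f z = blaschke \<Lambda> R z * exp (g z) \<and> Re (g z) \<le> C + delta \<Lambda> R)"
proof -
  have fock: "f \<in> fock_space" and hz: "has_zeros f \<Lambda>" and co: "fps_nth (fps_expansion f 0) (\<Lambda> 0) = 1"
    using f by (auto simp: normalized_fock_def)
  obtain C where C: "C \<ge> 0" "\<And>z. cmod (f z) \<le> exp (C + (cmod z)\<^sup>2 / 2)"
    using fock_growth[OF fock] by blast
  have "\<exists>g. g holomorphic_on ball 0 R \<and> g 0 = 0 \<and>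
       (\<forall>z\<in>ball 0 R. f z = blaschke \<Lambda> R z * exp (g z) \<and> Re (g z) \<le> C + delta \<Lambda> R)"
    if R: "R > 0" for R
  proof -
    obtain q where q: "q holomorphic_on blaschke_domain \<Lambda> R"
      "\<And>z. z \<in> blaschke_domain \<Lambda> R \<Longrightarrow> f z = blaschke \<Lambda> R z * q z"
      "\<And>z. z \<in> ball 0 R \<Longrightarrow> q z \<noteq> 0" "q 0 = fps_nth (fps_expansion f 0) (\<Lambda> 0)"
      using has_zeros_blaschke_quotient[OF lf hz R] by blast
    have sub: "cball 0 R \<subseteq> blaschke_domain \<Lambda> R" by (rule cball_subset_blaschke_domain)
    have subb: "ball 0 R \<subseteq> blaschke_domain \<Lambda> R" by (rule ball_subset_blaschke_domain) simp
    have holq: "q holomorphic_on ball 0 R" by (rule holomorphic_on_subset[OF q(1) subb])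
    have bnd: "cmod (q z) \<le> exp (C + delta \<Lambda> R)" if z: "z \<in> ball 0 R" for z
    proof (rule maximum_modulus_frontier[OF _ _ _ _ z])
      show "q holomorphic_on interior (ball 0 R)" using holq by simp
      show "continuous_on (closure (ball 0 R)) q"
        using R continuous_on_subset[OF holomorphic_on_imp_continuous_on[OF q(1)] sub] by simp
      fix w :: complex assume "w \<in> frontier (ball 0 R)"
      then have w: "cmod w = R" using R by simp
      then have "f w = blaschke \<Lambda> R w * q w" using sub by (intro q) auto
      then have "exp (jensen_sum \<Lambda> R) * cmod (q w) \<le> exp (C + R\<^sup>2 / 2)"
        using C(2)[of w] w norm_blaschke_sphere[OF lf R w] by (simp add: norm_mult)
      then have "cmod (q w) \<le> exp (C + R\<^sup>2 / 2) / exp (jensen_sum \<Lambda> R)"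
        by (simp add: field_simps)
      also have "\<dots> = exp (C + (R\<^sup>2 / 2 - jensen_sum \<Lambda> R))" by (simp add: exp_diff exp_add)
      also have "\<dots> \<le> exp (C + delta \<Lambda> R)" by (simp add: delta_def)
      finally show "cmod (q w) \<le> exp (C + delta \<Lambda> R)" .
    qed auto
    obtain g where g: "g holomorphic_on ball 0 R" "\<And>z. z \<in> ball 0 R \<Longrightarrow> exp (g z) = q z"
      using holomorphic_logarithm_exists[of "ball 0 R" q 0] holq q(3) R by auto
    have eg0: "exp (g 0) = 1" using g(2)[of 0] R q(4) co by simp
    show ?thesis
    proof (intro exI[of _ "\<lambda>z. g z - g 0"] conjI ballI)
      show "(\<lambda>z. g z - g 0) holomorphic_on ball 0 R" by (intro holomorphic_intros g)
      fix z :: complex assume z: "z \<in> ball 0 R"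
      have e: "exp (g z - g 0) = q z" using g(2)[OF z] eg0 by (simp add: exp_diff)
      show "f z = blaschke \<Lambda> R z * exp (g z - g 0)" using q(2) z subb by (auto simp: e)
      have "exp (Re (g z - g 0)) \<le> exp (C + delta \<Lambda> R)"
        using bnd[OF z] unfolding e[symmetric] by simp
      then show "Re (g z - g 0) \<le> C + delta \<Lambda> R" by (simp only: exp_le_cancel_iff)
    qed simp
  qed
  with C(1) show ?thesis by (rule that)
qed

text \<open>The competitor whose exponent is the Taylor polynomial of \<open>g = log (f / B)\<close> equals
  \<open>f exp (- T)\<close> with \<open>T\<close> the Taylor remainder. The condition on the radii is exactly what bounds
  \<open>\<bar>T\<bar>\<close> by \<open>D (\<bar>z\<bar> / k)\<^bsup>p+1\<^esup>\<close> on \<open>\<bar>z\<bar> < k\<close>, with \<open>D\<close> independent of \<open>k\<close>: this supplies the dominating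
  function \<open>exp (2 D) \<bar>f\<bar>\<^sup>2\<close> as well as the pointwise convergence.\<close>

lemma competitors_approximating_normalized_fock:
  assumes lf: "locally_finite \<Lambda>" and f: "f \<in> normalized_fock \<Lambda>" and adm: "admissible_radii \<Lambda> p R"
  obtains a where "(\<lambda>k. gauss_normsq (ball 0 (real k)) (competitor \<Lambda> p (R k) (a k)))
      \<longlonglongrightarrow> gauss_normsq UNIV f"
proof -
  obtain C where C: "C \<ge> 0" and fac:
    "\<And>R. R > 0 \<Longrightarrow> \<exists>g. g holomorphic_on ball 0 R \<and> g 0 = 0 \<and>
       (\<forall>z\<in>ball 0 R. f z = blaschke \<Lambda> R z * exp (g z) \<and> Re (g z) \<le> C + delta \<Lambda> R)"
    using normalized_fock_factorization[OF lf f] by blast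
  have contf: "continuous_on UNIV f" and fin: "gauss_normsq UNIV f < \<infinity>"
    using f by (auto simp: normalized_fock_def fock_space_def intro: holomorphic_on_imp_continuous_on)
  have Rk1: "2 * real k \<le> R k" if "k \<ge> 1" for k
    using adm that by (simp add: admissible_radii_def)
  have Rk: "2 * real k \<le> R k" "R k > 0" "real k < R k" if "k \<ge> 1" for k
    using Rk1[OF that] that by linarith+
  define D where "D = 16 * (C + 1) * (3 / 2) ^ (p + 1)"
  have D: "D \<ge> 0" using C by (simp add: D_def)
  have "\<exists>a T. (\<forall>z\<in>ball 0 (real k). competitor \<Lambda> p (R k) a z = f z * exp (- T z) \<and>
              cmod (T z) \<le> D * (cmod z / real k) ^ (p + 1))" if k: "k \<ge> 1" for k
  proof -
    obtain g where g: "g holomorphic_on ball 0 (R k)" "g 0 = 0"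
       "\<And>z. z \<in> ball 0 (R k) \<Longrightarrow> f z = blaschke \<Lambda> (R k) z * exp (g z) \<and> Re (g z) \<le> C + delta \<Lambda> (R k)"
      using fac[OF Rk(2)[OF k]] by blast
    \<comment> \<open>the extra \<open>1\<close> makes the bound on \<open>Re g\<close> strict and \<open>A\<close> positive\<close>
    define A where "A = C + delta \<Lambda> (R k) + 1"
    have d0: "delta \<Lambda> (R k) \<ge> 0" by (simp add: delta_def)
    have A: "A > 0" "A \<le> (C + 1) * defect \<Lambda> (R k)"
      using C d0 by (auto simp: A_def defect_def algebra_simps)
    define a where "a = (\<lambda>j. (deriv ^^ j) g 0 / fact j)"
    define T where "T = (\<lambda>z. g z - (\<Sum>j=1..p. a j * z ^ j))"
    show ?thesis
    proof (intro exI ballI conjI)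
      fix z assume z: "z \<in> ball (0::complex) (real k)"
      then have zR: "z \<in> ball 0 (R k)" and z2: "2 * cmod z \<le> R k" using Rk[OF k] by auto
      show "competitor \<Lambda> p (R k) a z = f z * exp (- T z)"
        using g(3)[OF zR] by (simp add: competitor_def T_def exp_diff exp_minus field_simps)
      have "cmod (T z) \<le> 16 * A * (3 / 2) ^ (p + 1) * (cmod z / R k) ^ (p + 1)"
        unfolding T_def a_def
      proof (rule Taylor_remainder_bound[OF g(1,2) A(1) Rk(2)[OF k] _ z2])
        fix w :: complex assume "w \<in> ball 0 (R k)"
        with g(3)[of w] show "Re (g w) < A" by (simp add: A_def)
      qed
      also have "\<dots> \<le> 16 * ((C + 1) * defect \<Lambda> (R k)) * (3 / 2) ^ (p + 1) * (cmod z / R k) ^ (p + 1)"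
        using Rk(2)[OF k] by (intro mult_right_mono mult_left_mono A) auto
      also have "\<dots> = D * (defect \<Lambda> (R k) * (real k / R k) ^ (p + 1)) * (cmod z / real k) ^ (p + 1)"
      proof -
        have "cmod z / R k = (real k / R k) * (cmod z / real k)" using k by simp
        then have "(cmod z / R k) ^ (p + 1) = (real k / R k) ^ (p + 1) * (cmod z / real k) ^ (p + 1)"
          by (simp only: power_mult_distrib)
        then show ?thesis by (simp only: D_def mult_ac)
      qed
      also have "\<dots> \<le> D * 1 * (cmod z / real k) ^ (p + 1)"
        using adm k D by (intro mult_right_mono mult_left_mono) (auto simp: admissible_radii_def)
      finally show "cmod (T z) \<le> D * (cmod z / real k) ^ (p + 1)" by simp
    qed
  qed
  then have "\<forall>k. \<exists>a T. k \<ge> 1 \<longrightarrow> (\<forall>z\<in>ball 0 (real k). competitor \<Lambda> p (R k) a z = f z * exp (- T z) \<and>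
              cmod (T z) \<le> D * (cmod z / real k) ^ (p + 1))" by blast
  then obtain a T where aT: "\<And>k z. k \<ge> 1 \<Longrightarrow> z \<in> ball 0 (real k) \<Longrightarrow>
      competitor \<Lambda> p (R k) (a k) z = f z * exp (- T k z) \<and> cmod (T k z) \<le> D * (cmod z / real k) ^ (p + 1)"
    by metis
  define u where "u = (\<lambda>k z. ennreal ((cmod (competitor \<Lambda> p (R k) (a k) z))\<^sup>2 * exp (- (cmod z)\<^sup>2)) * indicator (ball 0 (real k)) z)"
  define v where "v = (\<lambda>z. ennreal ((cmod (f z))\<^sup>2 * exp (- (cmod z)\<^sup>2)))"
  have u_meas: "u k \<in> borel_measurable lborel" for k
  proof (cases "k \<ge> 1")
    case True
    have "competitor \<Lambda> p (R k) (a k) holomorphic_on ball 0 (real k)"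
      unfolding competitor_def using Rk[OF True]
      by (intro holomorphic_intros ball_subset_blaschke_domain) auto
    then show ?thesis unfolding u_def
      by (intro gauss_integrand_measurable holomorphic_on_imp_continuous_on)
  next
    case False
    then have "k = 0" by simp
    then show ?thesis by (simp add: u_def)
  qed
  have v_meas [measurable]: "v \<in> borel_measurable lborel" unfolding v_def by (rule gauss_integrand_measurable_UNIV[OF contf])
  have gv: "gauss_normsq UNIV f = ennreal (1 / pi) * (\<integral>\<^sup>+z. v z \<partial>lborel)" by (simp add: gauss_normsq_def v_def)
  have v_fin: "(\<integral>\<^sup>+z. v z \<partial>lborel) < \<infinity>"
    using fin unfolding gv by (auto simp: ennreal_mult_less_top)
  have "(\<lambda>k. \<integral>\<^sup>+z. u k z \<partial>lborel) \<longlonglongrightarrow> (\<integral>\<^sup>+z. v z \<partial>lborel)"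
  proof (rule nn_integral_dominated_convergence[where w = "\<lambda>z. ennreal (exp (2 * D)) * v z"])
    show "(\<integral>\<^sup>+z. ennreal (exp (2 * D)) * v z \<partial>lborel) < \<infinity>"
      using v_fin by (subst nn_integral_cmult) (auto simp: ennreal_mult_less_top)
    show "AE z in lborel. u k z \<le> ennreal (exp (2 * D)) * v z" for k
    proof (intro AE_I2)
      fix z
      show "u k z \<le> ennreal (exp (2 * D)) * v z"
      proof (cases "z \<in> ball 0 (real k)")
        case True
        then have k: "k \<ge> 1" by (cases k) auto
        have "cmod (T k z) \<le> D * (cmod z / real k) ^ (p + 1)" using aT[OF k True] by blast
        also have "\<dots> \<le> D * 1"
          using True D k by (intro mult_left_mono power_le_one) (auto simp: divide_le_eq_1)
        finally have T: "cmod (T k z) \<le> D" by simp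
        have "cmod (exp (- T k z)) \<le> exp D"
          using T complex_Re_le_cmod[of "- T k z"] by simp
        then have "(cmod (exp (- T k z)))\<^sup>2 \<le> (exp D)\<^sup>2" by (intro power_mono) auto
        then have e: "(cmod (exp (- T k z)))\<^sup>2 \<le> exp (2 * D)" by (simp add: exp_double)
        have "(cmod (competitor \<Lambda> p (R k) (a k) z))\<^sup>2 * exp (- (cmod z)\<^sup>2) =
            (cmod (exp (- T k z)))\<^sup>2 * ((cmod (f z))\<^sup>2 * exp (- (cmod z)\<^sup>2))"
          using aT[OF k True] by (simp add: norm_mult power_mult_distrib del: norm_exp_eq_Re)
        also have "\<dots> \<le> exp (2 * D) * ((cmod (f z))\<^sup>2 * exp (- (cmod z)\<^sup>2))"
          by (intro mult_right_mono e) auto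
        finally show ?thesis using True by (simp add: u_def v_def ennreal_mult[symmetric] ennreal_leI del: norm_exp_eq_Re)
      qed (simp add: u_def)
    qed
    show "AE z in lborel. (\<lambda>k. u k z) \<longlonglongrightarrow> v z"
    proof (intro AE_I2)
      fix z :: complex
      have ev: "eventually (\<lambda>k. k \<ge> 1 \<and> z \<in> ball 0 (real k)) sequentially"
        using eventually_ge_at_top[of "1::nat"] filterlim_at_top_dense[THEN iffD1, OF filterlim_real_sequentially, rule_format, of "cmod z"]
        by eventually_elim auto
      have "(\<lambda>k. D * (cmod z / real k) ^ (p + 1)) \<longlonglongrightarrow> D * 0 ^ (p + 1)"
        by (intro tendsto_intros lim_const_over_n)
      then have "(\<lambda>k. T k z) \<longlonglongrightarrow> 0"
        using ev aT by (intro Lim_null_comparison[of "\<lambda>k. T k z"]) (auto elim!: eventually_mono)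
      then have "(\<lambda>k. ennreal ((cmod (f z * exp (- T k z)))\<^sup>2 * exp (- (cmod z)\<^sup>2))) \<longlonglongrightarrow>
          ennreal ((cmod (f z * exp (- 0)))\<^sup>2 * exp (- (cmod z)\<^sup>2))"
        by (intro tendsto_intros)
      then have "(\<lambda>k. ennreal ((cmod (f z * exp (- T k z)))\<^sup>2 * exp (- (cmod z)\<^sup>2))) \<longlonglongrightarrow> v z"
        by (simp add: v_def)
      then show "(\<lambda>k. u k z) \<longlonglongrightarrow> v z"
        by (rule Lim_transform_eventually) (use ev in \<open>eventually_elim, auto simp: u_def aT\<close>)
    qed
  qed (use u_meas in simp_all)
  then have "(\<lambda>k. ennreal (1 / pi) * (\<integral>\<^sup>+z. u k z \<partial>lborel)) \<longlonglongrightarrow> gauss_normsq UNIV f"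
    unfolding gv by (intro ennreal_tendsto_cmult) auto
  then show ?thesis by (intro that[of a]) (simp add: gauss_normsq_def u_def)
qed

section \<open>Limits of functions with bounded norm\<close>

lemma uniform_limit_subseq:
  assumes "uniform_limit K f l sequentially" "strict_mono r"
  shows "uniform_limit K (\<lambda>n. f (r n)) l sequentially"
  using assms eventually_subseq unfolding uniform_limit_iff by blast

text \<open>Fatou's lemma with moving domains. It is used with radii tending to infinity for the extremal
  problem, and with a constant radius for the attainment of the finite-dimensional minima.\<close>

lemma gauss_normsq_Fatou:
  assumes cont: "\<And>n. continuous_on (ball 0 (\<rho> n)) (h n)"
    and ev: "\<And>z. z \<in> S \<Longrightarrow> eventually (\<lambda>n. z \<in> ball 0 (\<rho> n)) sequentially"
    and lim: "\<And>z. z \<in> S \<Longrightarrow> (\<lambda>n. h n z) \<longlonglongrightarrow> g z"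
  shows "gauss_normsq S g \<le> liminf (\<lambda>n. gauss_normsq (ball 0 (\<rho> n)) (h n))"
proof -
  define c where "c = ennreal (1 / pi)"
  define u where "u = (\<lambda>n z. ennreal ((cmod (h n z))\<^sup>2 * exp (- (cmod z)\<^sup>2)) * indicator (ball 0 (\<rho> n)) z)"
  have meas [measurable]: "u n \<in> borel_measurable lborel" for n
    unfolding u_def by (rule gauss_integrand_measurable[OF cont])
  have le: "ennreal ((cmod (g z))\<^sup>2 * exp (- (cmod z)\<^sup>2)) * indicator S z \<le> liminf (\<lambda>n. u n z)" for z
  proof (cases "z \<in> S")
    case True
    have "(\<lambda>n. ennreal ((cmod (h n z))\<^sup>2 * exp (- (cmod z)\<^sup>2))) \<longlonglongrightarrow>
        ennreal ((cmod (g z))\<^sup>2 * exp (- (cmod z)\<^sup>2))"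
      by (intro tendsto_intros lim True)
    then have "(\<lambda>n. u n z) \<longlonglongrightarrow> ennreal ((cmod (g z))\<^sup>2 * exp (- (cmod z)\<^sup>2))"
      by (rule Lim_transform_eventually) (use ev[OF True] in \<open>eventually_elim, auto simp: u_def\<close>)
    then have "liminf (\<lambda>n. u n z) = ennreal ((cmod (g z))\<^sup>2 * exp (- (cmod z)\<^sup>2))"
      by (rule lim_imp_Liminf[rotated]) auto
    then show ?thesis using True by simp
  qed simp
  have "gauss_normsq S g \<le> c * (\<integral>\<^sup>+z. liminf (\<lambda>n. u n z) \<partial>lborel)"
    unfolding gauss_normsq_def c_def by (intro mult_left_mono nn_integral_mono le) auto
  also have "\<dots> \<le> c * liminf (\<lambda>n. \<integral>\<^sup>+z. u n z \<partial>lborel)"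
    by (intro mult_left_mono nn_integral_liminf meas) auto
  also have "\<dots> = liminf (\<lambda>n. c * (\<integral>\<^sup>+z. u n z \<partial>lborel))"
    by (intro Liminf_compose_continuous_mono[where f = "\<lambda>x. c * x", symmetric])
       (auto intro!: monoI mult_left_mono ennreal_tendsto_cmult simp: c_def continuous_on_def)
  finally show ?thesis by (simp add: gauss_normsq_def u_def c_def)
qed

text \<open>The functions live on different discs, so Montel's theorem, which wants a common domain, is applied
  on each \<open>ball 0 (n + 1)\<close> to a tail of the sequence, and the subsequences are diagonalized.\<close>

lemma gauss_bounded_normal_family:
  assumes \<rho>: "filterlim \<rho> at_top sequentially"
    and hol: "\<And>n. h n holomorphic_on ball 0 (\<rho> n)"
    and M: "\<And>n. gauss_normsq (ball 0 (\<rho> n)) (h n) \<le> ennreal M" "M \<ge> 0"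
  obtains r g where "strict_mono (r :: nat \<Rightarrow> nat)" "g holomorphic_on UNIV"
    "\<And>K. compact K \<Longrightarrow> uniform_limit K (\<lambda>n. h (r n)) g sequentially"
proof -
  define P where "P = (\<lambda>n (s :: nat \<Rightarrow> nat). \<exists>l. uniform_limit (cball 0 (real n)) (\<lambda>i. h (s i)) l sequentially)"
  have stable: "P n (s \<circ> r)" if "strict_mono r" "P n s" for r s :: "nat \<Rightarrow> nat" and n
    using that uniform_limit_subseq unfolding P_def o_def by blast
  have ex: "\<exists>r'. strict_mono r' \<and> P n (s \<circ> r')" if s: "strict_mono s" for n and s :: "nat \<Rightarrow> nat"
  proof -
    obtain N where N: "\<And>i. i \<ge> N \<Longrightarrow> \<rho> i \<ge> real n + 2"
      using \<rho> unfolding filterlim_at_top eventually_sequentially by meson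
    define F where "F = (\<lambda>i. h (s (i + N)))"
    have big: "\<rho> (s (i + N)) \<ge> real n + 2" for i
      using seq_suble[OF s, of "i + N"] by (intro N) simp
    have bnd: "cmod (F i z) \<le> sqrt (128 * exp 1 * M * exp ((real n + 1)\<^sup>2))"
      if z: "z \<in> ball 0 (real n + 1)" for i z
    proof (rule real_le_rsqrt)
      have sub: "ball z 1 \<subseteq> ball 0 (\<rho> (s (i + N)))"
      proof
        fix w assume "w \<in> ball z 1"
        then have "dist z w < 1" by simp
        moreover have "cmod w \<le> cmod z + dist z w"
          by (metis dist_norm norm_minus_commute norm_triangle_sub)
        ultimately show "w \<in> ball 0 (\<rho> (s (i + N)))" using z big[of i] by simp
      qed
      have "(cmod (F i z))\<^sup>2 \<le> 128 * exp 1 / 1\<^sup>2 * M * exp ((cmod z)\<^sup>2)"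
        unfolding F_def using sub
        by (intro gauss_pointwise_bound[OF _ _ _ sub M] holomorphic_on_subset[OF hol]) auto
      also have "\<dots> \<le> 128 * exp 1 / 1\<^sup>2 * M * exp ((real n + 1)\<^sup>2)"
        using z M(2) by (intro mult_left_mono) (auto intro!: power_mono)
      finally show "(cmod (F i z))\<^sup>2 \<le> 128 * exp 1 * M * exp ((real n + 1)\<^sup>2)" by simp
    qed
    have holF: "F i holomorphic_on ball 0 (real n + 1)" for i
      unfolding F_def using big[of i] by (intro holomorphic_on_subset[OF hol]) auto
    obtain l r where r: "strict_mono (r :: nat \<Rightarrow> nat)"
      and lim: "\<And>K. \<lbrakk>compact K; K \<subseteq> ball 0 (real n + 1)\<rbrakk> \<Longrightarrow> uniform_limit K (F \<circ> r) l sequentially"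
    proof (rule Montel[of "ball 0 (real n + 1)" "range F" F])
      fix K :: "complex set" assume "compact K" "K \<subseteq> ball 0 (real n + 1)"
      with bnd show "\<exists>B. \<forall>f\<in>range F. \<forall>z\<in>K. cmod (f z) \<le> B" by blast
    qed (use holF in auto)
    have "uniform_limit (cball 0 (real n)) (F \<circ> r) l sequentially" by (rule lim) auto
    then have "P n (s \<circ> (\<lambda>i. r i + N))" unfolding P_def F_def o_def by blast
    moreover have "strict_mono (\<lambda>i. r i + N)" using r by (simp add: strict_mono_def)
    ultimately show ?thesis by blast
  qed
  interpret subseqs P by unfold_locales (rule ex)
  define d where "d = diagseq"
  have d: "strict_mono d" unfolding d_def by (rule subseq_diagseq)
  have "\<exists>l. uniform_limit (cball 0 (real k)) (\<lambda>i. h (d i)) l sequentially" for k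
  proof -
    have "P k (diagseq \<circ> ((+) (Suc k)))" by (rule diagseq_holds[OF stable])
    then obtain l where l: "uniform_limit (cball 0 (real k)) (\<lambda>i. h (d (i + Suc k))) l sequentially"
      unfolding P_def o_def d_def by (auto simp: add.commute)
    then have "uniform_limit (cball 0 (real k)) (\<lambda>i. h (d i)) l sequentially"
      unfolding uniform_limit_iff
      using eventually_sequentially_seg[of _ "Suc k"] by blast
    then show ?thesis by blast
  qed
  then obtain l where l: "\<And>k. uniform_limit (cball 0 (real k)) (\<lambda>i. h (d i)) (l k) sequentially"
    by metis
  define g where "g = (\<lambda>z. lim (\<lambda>i. h (d i) z))"
  have ul: "uniform_limit (cball 0 (real k)) (\<lambda>i. h (d i)) g sequentially" for k
  proof -
    have "g z = l k z" if "z \<in> cball 0 (real k)" for z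
      unfolding g_def by (rule limI[OF tendsto_uniform_limitI[OF l that]])
    then show ?thesis using l[of k] unfolding uniform_limit_iff by simp
  qed
  have hol_g: "g holomorphic_on ball 0 (real k)" for k
  proof -
    have "eventually (\<lambda>n. \<rho> (d n) > real k) sequentially"
      using filterlim_compose[OF \<rho> filterlim_subseq[OF d]]
      unfolding filterlim_at_top_dense by blast
    then have "eventually (\<lambda>n. continuous_on (cball 0 (real k)) (h (d n)) \<and> h (d n) holomorphic_on ball 0 (real k)) sequentially"
    proof eventually_elim
      case (elim n)
      have "h (d n) holomorphic_on cball 0 (real k)"
        using elim by (intro holomorphic_on_subset[OF hol]) auto
      then show ?case
        using holomorphic_on_imp_continuous_on holomorphic_on_subset ball_subset_cball by blast
    qed
    from holomorphic_uniform_limit[OF this ul] show ?thesis by auto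
  qed
  have "g holomorphic_on UNIV"
  proof -
    have "g field_differentiable (at z)" for z
    proof -
      obtain k :: nat where "cmod z < real k" using reals_Archimedean2 by blast
      then show ?thesis by (intro holomorphic_on_imp_differentiable_at[OF hol_g[of k]]) auto
    qed
    then show ?thesis by (simp add: holomorphic_on_def)
  qed
  moreover have "uniform_limit K (\<lambda>i. h (d i)) g sequentially" if "compact K" for K
  proof -
    obtain B where "\<And>z. z \<in> K \<Longrightarrow> cmod z \<le> B" using compact_imp_bounded[OF \<open>compact K\<close>] by (auto simp: bounded_iff)
    moreover obtain k :: nat where "B < real k" using reals_Archimedean2 by blast
    ultimately have "K \<subseteq> cball 0 (real k)" by fastforce
    then show ?thesis by (rule uniform_limit_on_subset[OF ul])
  qed
  ultimately show ?thesis using that d by blast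
qed

text \<open>Division by the Blaschke product is harmless on a circle that carries no zero of it; the maximum
  principle then transports bounds on the quotient to the whole disc. Only finitely many radii are
  excluded.\<close>

lemma circle_avoiding_zeros:
  assumes lf: "locally_finite \<Lambda>" and s: "0 \<le> a" "a < b" "b \<le> R"
  obtains s c where "a < s" "s < b" "c > 0" "\<And>z. cmod z = s \<Longrightarrow> c \<le> cmod (blaschke \<Lambda> R z)"
proof -
  have "infinite ({a<..<b} - cmod ` inner_zeros \<Lambda> R)"
    using s finite_inner_zeros[OF lf, of R] by (intro Diff_infinite_finite) auto
  then have "{a<..<b} - cmod ` inner_zeros \<Lambda> R \<noteq> {}" by (rule infinite_imp_nonempty)
  then obtain s where s': "s \<in> {a<..<b} - cmod ` inner_zeros \<Lambda> R" by blast
  then have s0: "s > 0" "s < b" "a < s" using s by auto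
  have sub: "sphere 0 s \<subseteq> blaschke_domain \<Lambda> R"
    using cball_subset_blaschke_domain[of R \<Lambda>] s0 s by force
  have "continuous_on (sphere 0 s) (\<lambda>z. cmod (blaschke \<Lambda> R z))"
    by (intro continuous_intros holomorphic_on_imp_continuous_on blaschke_holomorphic sub)
  moreover have "sphere (0::complex) s \<noteq> {}" using s0 by auto
  ultimately obtain z0 where z0: "z0 \<in> sphere 0 s"
      "\<And>z. z \<in> sphere 0 s \<Longrightarrow> cmod (blaschke \<Lambda> R z0) \<le> cmod (blaschke \<Lambda> R z)"
    using continuous_attains_inf[of "sphere 0 s" "\<lambda>z. cmod (blaschke \<Lambda> R z)"] by auto
  have "blaschke \<Lambda> R z0 \<noteq> 0"
  proof
    assume "blaschke \<Lambda> R z0 = 0"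
    then have "\<Lambda> z0 > 0" using blaschke_eq_0_iff[OF lf, of z0 R] z0(1) s0 s sub by auto
    then have "z0 \<in> inner_zeros \<Lambda> R" using z0(1) s0 s by auto
    then show False using z0(1) s' by auto
  qed
  then show ?thesis using z0 s0 by (intro that[of s "cmod (blaschke \<Lambda> R z0)"]) auto
qed

lemma blaschke_quotient_bound:
  assumes q: "q holomorphic_on ball 0 R" and s: "0 < s" "s < R" and c: "c > 0"
      "\<And>z. cmod z = s \<Longrightarrow> c \<le> cmod (blaschke \<Lambda> R z)"
    and le: "\<And>z. cmod z = s \<Longrightarrow> cmod (blaschke \<Lambda> R z * q z) \<le> M" and z: "z \<in> cball 0 s"
  shows "cmod (q z) \<le> M / c"
proof (rule maximum_modulus_frontier[OF _ _ _ _ z])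
  show "q holomorphic_on interior (cball 0 s)"
    using s by (intro holomorphic_on_subset[OF q]) auto
  show "continuous_on (closure (cball 0 s)) q"
    using s by (intro continuous_on_subset[OF holomorphic_on_imp_continuous_on[OF q]]) auto
  fix w :: complex assume "w \<in> frontier (cball 0 s)"
  then have w: "cmod w = s" using s by simp
  have "c * cmod (q w) \<le> cmod (blaschke \<Lambda> R w) * cmod (q w)"
    by (intro mult_right_mono c w) auto
  also have "\<dots> \<le> M" using le[OF w] by (simp add: norm_mult)
  finally show "cmod (q w) \<le> M / c" using c(1) by (simp add: field_simps)
qed auto

text \<open>Hurwitz's theorem with multiplicities. The cofactors of the fixed Blaschke product of radius \<open>r\<close>
  are uniformly Cauchy, by the maximum principle for their differences on a circle without zeros, and
  their limit is zero-free by Hurwitz's theorem for zero-free functions. It cannot vanish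
  identically, because all cofactors are \<open>1\<close> at the origin.\<close>

lemma disc_divisor_uniform_limit:
  assumes lf: "locally_finite \<Lambda>" and r: "0 < a" "a < r"
    and h: "\<And>n. disc_divisor \<Lambda> r (h n)"
    and lim: "\<And>K. compact K \<Longrightarrow> K \<subseteq> ball 0 r \<Longrightarrow> uniform_limit K h g sequentially"
  shows "disc_divisor \<Lambda> a g"
proof -
  obtain q where q: "\<And>n. q n holomorphic_on ball 0 r" "\<And>n. q n 0 = 1"
      "\<And>n z. z \<in> ball 0 r \<Longrightarrow> q n z \<noteq> 0" "\<And>n z. z \<in> ball 0 r \<Longrightarrow> h n z = blaschke \<Lambda> r z * q n z"
    using h unfolding disc_divisor_def by metis
  \<comment> \<open>the circle of radius \<open>a\<close> itself may carry zeros, whence the detour through a larger one\<close>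
  obtain s c where s: "a < s" "s < r" and c: "c > 0" "\<And>z. cmod z = s \<Longrightarrow> c \<le> cmod (blaschke \<Lambda> r z)"
    using circle_avoiding_zeros[OF lf less_imp_le[OF r(1)] r(2) order_refl] by blast
  have s0: "s > 0" and sub: "cball 0 s \<subseteq> ball (0::complex) r" using s r by auto
  have limh: "uniform_limit (cball 0 s) h g sequentially" by (rule lim[OF _ sub]) auto
  have "uniformly_Cauchy_on (cball 0 s) q"
  proof (rule uniformly_Cauchy_onI)
    fix e :: real assume e: "e > 0"
    have "uniformly_Cauchy_on (cball 0 s) h"
      using limh uniformly_convergent_Cauchy uniformly_convergentI by blast
    then obtain N where N: "\<And>x m n. x \<in> cball 0 s \<Longrightarrow> m \<ge> N \<Longrightarrow> n \<ge> N \<Longrightarrow> dist (h m x) (h n x) < e * c / 2"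
      using e c(1) unfolding uniformly_Cauchy_on_def by (meson half_gt_zero mult_pos_pos)
    have "dist (q m x) (q n x) < e" if x: "x \<in> cball 0 s" and mn: "m \<ge> N" "n \<ge> N" for x m n
    proof -
      have "cmod (q m x - q n x) \<le> (e * c / 2) / c"
      proof (rule blaschke_quotient_bound[OF _ s0 s(2) c _ x])
        show "(\<lambda>x. q m x - q n x) holomorphic_on ball 0 r" by (intro holomorphic_intros q)
        fix z :: complex assume z: "cmod z = s"
        then have zr: "z \<in> ball 0 r" and zs: "z \<in> cball 0 s" using s by auto
        have "cmod (blaschke \<Lambda> r z * (q m z - q n z)) = dist (h m z) (h n z)"
          using q(4)[OF zr] by (simp add: dist_norm right_diff_distrib)
        then show "cmod (blaschke \<Lambda> r z * (q m z - q n z)) \<le> e * c / 2"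
          using N[OF zs mn] by simp
      qed
      then show ?thesis using e c(1) by (simp add: dist_norm)
    qed
    then show "\<exists>M. \<forall>x\<in>cball 0 s. \<forall>m\<ge>M. \<forall>n\<ge>M. dist (q m x) (q n x) < e" by blast
  qed
  then obtain u where u: "uniform_limit (cball 0 s) q u sequentially"
    using Cauchy_uniformly_convergent unfolding uniformly_convergent_on_def by blast
  have "eventually (\<lambda>n. continuous_on (cball 0 s) (q n) \<and> q n holomorphic_on ball 0 s) sequentially"
  proof (intro always_eventually allI conjI)
    fix n
    show "continuous_on (cball 0 s) (q n)"
      by (rule continuous_on_subset[OF holomorphic_on_imp_continuous_on[OF q(1)] sub])
    show "q n holomorphic_on ball 0 s"
      by (rule holomorphic_on_subset[OF q(1) subset_trans[OF ball_subset_cball sub]])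
  qed
  then have holu: "u holomorphic_on ball 0 s"
    using holomorphic_uniform_limit[OF _ u] by auto
  have pt: "(\<lambda>n. q n z) \<longlonglongrightarrow> u z" if "z \<in> cball 0 s" for z
    by (rule tendsto_uniform_limitI[OF u that])
  have u0: "u 0 = 1" using LIMSEQ_unique[OF pt[of 0]] s0 q(2) by auto
  have unz: "u z \<noteq> 0" if z: "z \<in> ball 0 s" for z
  proof (cases "u constant_on ball 0 s")
    case True
    then have "u z = u 0" using z s0 unfolding constant_on_def by (metis centre_in_ball)
    then show ?thesis using u0 by simp
  next
    case False
    show ?thesis
    proof (rule Hurwitz_no_zeros[OF _ _ _ holu _ False _ z])
      fix n show "q n holomorphic_on ball 0 s"
        using s by (intro holomorphic_on_subset[OF q(1)]) auto
      show "q n z \<noteq> 0" if "z \<in> ball 0 s" for z using that s by (intro q(3)) auto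
    next
      fix K :: "complex set" assume "K \<subseteq> ball 0 s"
      then show "uniform_limit K q u sequentially"
        using ball_subset_cball by (intro uniform_limit_on_subset[OF u]) blast
    qed auto
  qed
  have gu: "g z = blaschke \<Lambda> r z * u z" if z: "z \<in> ball 0 s" for z
  proof -
    have zs: "z \<in> cball 0 s" and zr: "z \<in> ball 0 r" using z s by auto
    have "(\<lambda>n. h n z) \<longlonglongrightarrow> blaschke \<Lambda> r z * u z"
      unfolding q(4)[OF zr] by (intro tendsto_intros pt zs)
    then show ?thesis using tendsto_uniform_limitI[OF limh zs] LIMSEQ_unique by blast
  qed
  have "disc_divisor \<Lambda> s g"
    using s by (intro disc_divisorI[OF lf s0 _ holu u0 unz gu]) auto
  then show ?thesis using s r by (intro disc_divisor_mono[OF lf, of a s]) auto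
qed

text \<open>The compactness statement behind the lower bound, the existence of extremal functions and the
  convergence of minimizers.\<close>

lemma normalized_limit_of_disc_divisors:
  assumes lf: "locally_finite \<Lambda>" and \<rho>: "filterlim \<rho> at_top sequentially"
    and h: "\<And>n. disc_divisor \<Lambda> (\<rho> n) (h n)"
    and M: "\<And>n. gauss_normsq (ball 0 (\<rho> n)) (h n) \<le> ennreal M" "M \<ge> 0"
  obtains r g where "strict_mono (r :: nat \<Rightarrow> nat)" "g \<in> normalized_fock \<Lambda>"
    "\<And>K. compact K \<Longrightarrow> uniform_limit K (\<lambda>n. h (r n)) g sequentially"
    "gauss_normsq UNIV g \<le> liminf (\<lambda>n. gauss_normsq (ball 0 (\<rho> (r n))) (h (r n)))"
proof -
  have hol: "h n holomorphic_on ball 0 (\<rho> n)" for n by (rule disc_divisor_holomorphic[OF h])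
  obtain r g where r: "strict_mono (r :: nat \<Rightarrow> nat)" and g: "g holomorphic_on UNIV"
    and lim: "\<And>K. compact K \<Longrightarrow> uniform_limit K (\<lambda>n. h (r n)) g sequentially"
    using gauss_bounded_normal_family[OF \<rho> hol M] by blast
  have \<rho>r: "filterlim (\<lambda>n. \<rho> (r n)) at_top sequentially"
    using filterlim_compose[OF \<rho> filterlim_subseq[OF r]] .
  have dd: "disc_divisor \<Lambda> a g" if a: "a > 0" for a
  proof -
    obtain N where N: "\<And>n. n \<ge> N \<Longrightarrow> \<rho> (r n) \<ge> a + 1"
      using \<rho>r unfolding filterlim_at_top eventually_sequentially by meson
    show ?thesis
    proof (rule disc_divisor_uniform_limit[OF lf a, of "a + 1" "\<lambda>n. h (r (n + N))"])
      fix n show "disc_divisor \<Lambda> (a + 1) (h (r (n + N)))"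
        using a by (intro disc_divisor_mono[OF lf _ N h]) auto
    next
      fix K :: "complex set" assume "compact K"
      then show "uniform_limit K (\<lambda>n. h (r (n + N))) g sequentially"
        using uniform_limit_subseq[OF lim, of K "\<lambda>n. n + N"] by (simp add: strict_mono_def)
    qed auto
  qed
  have Fatou: "gauss_normsq UNIV g \<le> liminf (\<lambda>n. gauss_normsq (ball 0 (\<rho> (r n))) (h (r n)))"
  proof (rule gauss_normsq_Fatou)
    show "continuous_on (ball 0 (\<rho> (r n))) (h (r n))" for n
      by (rule holomorphic_on_imp_continuous_on[OF hol])
    fix z :: complex
    show "eventually (\<lambda>n. z \<in> ball 0 (\<rho> (r n))) sequentially"
      using \<rho>r unfolding filterlim_at_top_dense by simp
    show "(\<lambda>n. h (r n) z) \<longlonglongrightarrow> g z"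
      by (rule tendsto_uniform_limitI[OF lim[of "{z}"]]) auto
  qed
  also have "\<dots> \<le> limsup (\<lambda>n. gauss_normsq (ball 0 (\<rho> (r n))) (h (r n)))"
    by (intro Liminf_le_Limsup) auto
  also have "\<dots> \<le> ennreal M" by (intro Limsup_bounded always_eventually allI M)
  finally have "gauss_normsq UNIV g < \<infinity>" by (simp add: le_less_trans)
  then have "g \<in> normalized_fock \<Lambda>"
    using disc_divisors_imp_has_zeros[OF lf dd] g by (simp add: normalized_fock_def fock_space_def)
  with r lim Fatou show ?thesis using that by blast
qed

section \<open>Attainment of the finite-dimensional minima\<close>

lemma coefficientwise_convergent_subsequence:
  fixes A :: "nat \<Rightarrow> nat \<Rightarrow> complex"
  assumes "\<And>j. j \<in> {1..p} \<Longrightarrow> bounded (range (\<lambda>n. A n j))"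
  shows "\<exists>r l. strict_mono (r :: nat \<Rightarrow> nat) \<and> (\<forall>j\<in>{1..p}. (\<lambda>n. A (r n) j) \<longlonglongrightarrow> l j)"
  using assms
proof (induction p)
  case 0
  show ?case by (intro exI[of _ id]) (auto simp: strict_mono_def)
next
  case (Suc p)
  then obtain r l where r: "strict_mono (r :: nat \<Rightarrow> nat)" "\<forall>j\<in>{1..p}. (\<lambda>n. A (r n) j) \<longlonglongrightarrow> l j"
    by fastforce
  have "bounded (range (\<lambda>n. A (r n) (Suc p)))"
    by (rule bounded_subset[OF Suc.prems[of "Suc p"]]) auto
  then obtain x t where t: "strict_mono (t :: nat \<Rightarrow> nat)" "(\<lambda>n. A (r (t n)) (Suc p)) \<longlonglongrightarrow> x"
    using bounded_imp_convergent_subsequence[of "\<lambda>n. A (r n) (Suc p)"] by (auto simp: o_def)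
  have "(\<lambda>n. A ((r \<circ> t) n) j) \<longlonglongrightarrow> (l(Suc p := x)) j" if j: "j \<in> {1..Suc p}" for j
  proof (cases "j = Suc p")
    case True
    then show ?thesis using t by simp
  next
    case False
    then have "(\<lambda>n. A (r n) j) \<longlonglongrightarrow> l j" using j r by auto
    then show ?thesis using LIMSEQ_subseq_LIMSEQ[OF _ t(1)] False by (fastforce simp: o_def)
  qed
  moreover have "strict_mono (r \<circ> t)" using r t by (intro strict_mono_o)
  ultimately show ?case by blast
qed

text \<open>Lets the coefficient bound for Taylor series apply to the parameters of a competitor.\<close>

lemma Taylor_coeff_polynomial:
  fixes a :: "nat \<Rightarrow> complex"
  assumes "j \<in> {1..p}"
  shows "(deriv ^^ j) (\<lambda>z. \<Sum>i=1..p. a i * z ^ i) 0 / fact j = a j"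
proof -
  have "(\<lambda>z. \<Sum>i=1..p. a i * z ^ i) has_fps_expansion (\<Sum>i=1..p. fps_const (a i) * fps_X ^ i)"
    by (intro fps_expansion_intros)
  then have "fps_expansion (\<lambda>z. \<Sum>i=1..p. a i * z ^ i) 0 = (\<Sum>i=1..p. fps_const (a i) * fps_X ^ i)"
    by (rule fps_expansion_eqI)
  then have "fps_nth (fps_expansion (\<lambda>z. \<Sum>i=1..p. a i * z ^ i) 0) j = (\<Sum>i=1..p. if j = i then a i else 0)"
    by (simp add: fps_sum_nth fps_X_power_nth if_distrib cong: if_cong)
  also have "\<dots> = a j" using assms by simp
  finally show ?thesis by (simp add: fps_expansion_def)
qed

lemma competitor_holomorphic:
  "r \<le> R \<Longrightarrow> competitor \<Lambda> p R a holomorphic_on ball 0 r"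
  unfolding competitor_def by (intro holomorphic_intros ball_subset_blaschke_domain)

lemma competitor_disc_divisor:
  assumes "locally_finite \<Lambda>" "0 < r" "r \<le> R"
  shows "disc_divisor \<Lambda> r (competitor \<Lambda> p R a)"
  by (rule disc_divisorI[OF assms, of "\<lambda>z. exp (\<Sum>j=1..p. a j * z ^ j)"])
     (auto intro!: holomorphic_intros simp: competitor_def power_0_left)

text \<open>Coercivity of the finite-dimensional problem. A bound on the norm bounds the competitor on a small
  circle that avoids the zeros of the Blaschke product, hence bounds the exponential factor on the
  enclosed disc; the exponent then has real part bounded above there and vanishes at \<open>0\<close>, so its
  coefficients are bounded. The radius is kept in \<open>(1/4, 1/2)\<close> so that discs of radius \<open>1/2\<close> about
  its points stay inside the unit disc.\<close>

lemma competitor_coeff_bound: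
  assumes lf: "locally_finite \<Lambda>" and r: "1 \<le> r" "r \<le> R" and M: "M \<ge> 0"
  obtains b where "\<And>a j. gauss_normsq (ball 0 r) (competitor \<Lambda> p R a) \<le> ennreal M \<Longrightarrow>
      j \<in> {1..p} \<Longrightarrow> cmod (a j) \<le> b j"
proof -
  obtain s c where s: "1 / 4 < s" "s < 1 / 2" and c: "c > 0" "\<And>z. cmod z = s \<Longrightarrow> c \<le> cmod (blaschke \<Lambda> R z)"
    using circle_avoiding_zeros[OF lf, of "1/4" "1/2" R] r by auto
  define K where "K = sqrt (128 * exp 1 / (1 / 2)\<^sup>2 * M * exp 1)"
  define A where "A = max 0 (ln (K / c)) + 1"
  show ?thesis
  proof (rule that[of "\<lambda>j. 4 * A / (2 * s / 3) ^ j"])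
    fix a j assume N: "gauss_normsq (ball 0 r) (competitor \<Lambda> p R a) \<le> ennreal M" and j: "j \<in> {1..p}"
    define P where "P = (\<lambda>z. \<Sum>j=1..p. a j * z ^ j)"
    have comp: "competitor \<Lambda> p R a z = blaschke \<Lambda> R z * exp (P z)" for z
      by (simp add: competitor_def P_def)
    have bnd: "cmod (blaschke \<Lambda> R z * exp (P z)) \<le> K" if z: "cmod z = s" for z
      unfolding K_def
    proof (rule real_le_rsqrt)
      have sub: "ball z (1 / 2) \<subseteq> ball 0 r"
      proof
        fix w assume "w \<in> ball z (1 / 2)"
        then have "dist z w < 1 / 2" by simp
        moreover have "cmod w \<le> cmod z + dist z w"
          by (metis dist_norm norm_minus_commute norm_triangle_sub)
        ultimately show "w \<in> ball 0 r" using z s r by simp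
      qed
      have "(cmod (competitor \<Lambda> p R a z))\<^sup>2 \<le> 128 * exp 1 / (1 / 2)\<^sup>2 * M * exp ((cmod z)\<^sup>2)"
        by (intro gauss_pointwise_bound[OF _ _ _ sub N M] holomorphic_on_subset[OF competitor_holomorphic[OF r(2)] sub]) auto
      also have "\<dots> \<le> 128 * exp 1 / (1 / 2)\<^sup>2 * M * exp 1"
        using z s M by (intro mult_left_mono) (auto intro!: power_le_one)
      finally show "(cmod (blaschke \<Lambda> R z * exp (P z)))\<^sup>2 \<le> 128 * exp 1 / (1 / 2)\<^sup>2 * M * exp 1"
        by (simp only: comp)
    qed
    have holP: "P holomorphic_on S" for S unfolding P_def by (intro holomorphic_intros)
    have Re: "Re (P z) < A" if z: "z \<in> ball 0 s" for z
    proof -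
      have "cmod (exp (P z)) \<le> K / c"
        using s r z by (intro blaschke_quotient_bound[OF _ _ _ c bnd] holomorphic_intros holP) auto
      then have e: "exp (Re (P z)) \<le> K / c" by simp
      then have "K / c > 0" using less_le_trans[OF exp_gt_zero e] by simp
      then have "Re (P z) \<le> ln (K / c)" using e by (simp add: ln_ge_iff)
      then show ?thesis by (simp add: A_def)
    qed
    have "cmod ((deriv ^^ j) P 0 / fact j) \<le> 4 * A / (2 * s / 3) ^ j"
    proof (rule Taylor_coeff_bound[OF holP _ _ _ Re])
      show "P 0 = 0" by (auto simp: P_def power_0_left intro!: sum.neutral)
    qed (use s in \<open>auto simp: A_def\<close>)
    then show "cmod (a j) \<le> 4 * A / (2 * s / 3) ^ j"
      unfolding P_def Taylor_coeff_polynomial[OF j] .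
  qed
qed

text \<open>The direct method: parameters of a minimizing sequence have a convergent subsequence by coercivity,
  and Fatou's lemma gives lower semicontinuity of the norm.\<close>

lemma finite_min_attained:
  assumes lf: "locally_finite \<Lambda>" and k: "k \<ge> 1" and R: "real k \<le> R k"
  shows "\<exists>a. is_minimizer \<Lambda> p R k a"
proof -
  define N where "N = (\<lambda>a. gauss_normsq (ball 0 (real k)) (competitor \<Lambda> p (R k) a))"
  define E where "E = (INF a. N a)"
  have E: "finite_min \<Lambda> p R k = E" by (simp add: finite_min_def E_def N_def)
  show ?thesis
  proof (cases "E = \<infinity>")
    case True
    then have "N a = \<infinity>" for a unfolding E_def by (metis INF_lower UNIV_I infinity_ennreal_def top.extremum_unique)
    then show ?thesis using True by (auto simp: is_minimizer_def E N_def)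
  next
    case False
    then obtain e where e: "E = ennreal e" "e \<ge> 0" by (cases E) auto
    have "\<exists>a. N a < ennreal (e + 1 / (real n + 1))" for n :: nat
    proof -
      have "E < ennreal (e + 1 / (real n + 1))" using e by (simp add: ennreal_lessI add_pos_nonneg)
      then show ?thesis unfolding E_def by (simp add: INF_less_iff)
    qed
    then obtain A where A: "\<And>n :: nat. N (A n) < ennreal (e + 1 / (real n + 1))" by metis
    have A1: "N (A n) \<le> ennreal (e + 1)" for n
      using e by (intro order_trans[OF less_imp_le[OF A[of n]]] ennreal_leI) auto
    obtain b where b: "\<And>a j. N a \<le> ennreal (e + 1) \<Longrightarrow> j \<in> {1..p} \<Longrightarrow> cmod (a j) \<le> b j"
      using competitor_coeff_bound[OF lf, of "real k" "R k" "e + 1" p] k R e unfolding N_def by auto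
    have "bounded (range (\<lambda>n. A n j))" if "j \<in> {1..p}" for j
      using b[OF A1 that] by (auto simp: bounded_iff)
    then obtain r l where r: "strict_mono (r :: nat \<Rightarrow> nat)" and
      l: "\<And>j. j \<in> {1..p} \<Longrightarrow> (\<lambda>n. A (r n) j) \<longlonglongrightarrow> l j"
      using coefficientwise_convergent_subsequence[of p A] by blast
    have "N l \<le> liminf (\<lambda>n. N (A (r n)))"
      unfolding N_def
    proof (rule gauss_normsq_Fatou)
      show "continuous_on (ball 0 (real k)) (competitor \<Lambda> p (R k) (A (r n)))" for n
        by (intro holomorphic_on_imp_continuous_on competitor_holomorphic R)
      show "(\<lambda>n. competitor \<Lambda> p (R k) (A (r n)) z) \<longlonglongrightarrow> competitor \<Lambda> p (R k) l z" for z
        unfolding competitor_def by (intro tendsto_intros l)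
    qed simp
    also have "\<dots> \<le> limsup (\<lambda>n. N (A (r n)))" by (intro Liminf_le_Limsup) auto
    also have "\<dots> \<le> limsup (\<lambda>n. ennreal (e + 1 / (real (r n) + 1)))"
      by (intro Limsup_mono always_eventually allI less_imp_le A)
    also have "\<dots> = ennreal e"
    proof (rule lim_imp_Limsup)
      have "(\<lambda>n. e + 1 / (real n + 1)) \<longlonglongrightarrow> e + 0"
        by (intro tendsto_intros) (use LIMSEQ_inverse_real_of_nat in \<open>simp add: inverse_eq_divide add.commute\<close>)
      then have "(\<lambda>n. ennreal (e + 1 / (real n + 1))) \<longlonglongrightarrow> ennreal e"
        by (intro tendsto_ennrealI) simp
      then show "(\<lambda>n. ennreal (e + 1 / (real (r n) + 1))) \<longlonglongrightarrow> ennreal e"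
        using LIMSEQ_subseq_LIMSEQ[OF _ r] by (fastforce simp: o_def)
    qed simp
    finally have "N l \<le> E" by (simp add: e)
    moreover have "E \<le> N l" unfolding E_def by (rule INF_lower) simp
    ultimately show ?thesis by (intro exI[of _ l]) (simp add: is_minimizer_def E N_def)
  qed
qed

section \<open>The extremal problem\<close>

lemma has_zeros_normalize:
  assumes lf: "locally_finite \<Lambda>" and f: "has_zeros f \<Lambda>" and r: "r > 0"
  defines "c \<equiv> fps_nth (fps_expansion f 0) (\<Lambda> 0)"
  shows "c \<noteq> 0" "disc_divisor \<Lambda> r (\<lambda>z. f z / c)"
proof -
  obtain q where q: "q holomorphic_on blaschke_domain \<Lambda> r"
    "\<And>z. z \<in> blaschke_domain \<Lambda> r \<Longrightarrow> f z = blaschke \<Lambda> r z * q z"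
    "\<And>z. z \<in> ball 0 r \<Longrightarrow> q z \<noteq> 0" "q 0 = c"
    using has_zeros_blaschke_quotient[OF lf f r] unfolding c_def by blast
  have sub: "ball 0 r \<subseteq> blaschke_domain \<Lambda> r" by (rule ball_subset_blaschke_domain) simp
  show c: "c \<noteq> 0" using q(3)[of 0] r q(4) by simp
  show "disc_divisor \<Lambda> r (\<lambda>z. f z / c)" unfolding disc_divisor_def
  proof (intro exI[of _ "\<lambda>z. q z / c"] conjI ballI)
    show "(\<lambda>z. q z / c) holomorphic_on ball 0 r"
      using c by (intro holomorphic_intros holomorphic_on_subset[OF q(1) sub])
  qed (use c q sub in auto)
qed

lemma normalized_fock_disc_divisor:
  assumes lf: "locally_finite \<Lambda>" and f: "f \<in> normalized_fock \<Lambda>" and r: "r > 0"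
  shows "disc_divisor \<Lambda> r f"
  using has_zeros_normalize(2)[OF lf _ r, of f] f by (simp add: normalized_fock_def)

lemma fock_zero_set_iff_normalized:
  assumes lf: "locally_finite \<Lambda>"
  shows "fock_zero_set \<Lambda> \<longleftrightarrow> normalized_fock \<Lambda> \<noteq> {}"
proof
  assume "fock_zero_set \<Lambda>"
  then obtain f where f: "f \<in> fock_space" "has_zeros f \<Lambda>" by (auto simp: fock_zero_set_def)
  define c where "c = fps_nth (fps_expansion f 0) (\<Lambda> 0)"
  have dd: "disc_divisor \<Lambda> r (\<lambda>z. f z / c)" if "r > 0" for r
    unfolding c_def by (rule has_zeros_normalize(2)[OF lf f(2) that])
  have contf: "continuous_on UNIV f" and fin: "gauss_normsq UNIV f < \<infinity>"
    using f by (auto simp: fock_space_def intro: holomorphic_on_imp_continuous_on)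
  have "gauss_normsq UNIV (\<lambda>z. f z / c) = ennreal (1 / pi) *
      (\<integral>\<^sup>+z. ennreal (1 / (cmod c)\<^sup>2) * ennreal ((cmod (f z))\<^sup>2 * exp (- (cmod z)\<^sup>2)) \<partial>lborel)"
    by (simp add: gauss_normsq_def norm_divide power_divide ennreal_mult[symmetric])
  also have "\<dots> = ennreal (1 / (cmod c)\<^sup>2) * gauss_normsq UNIV f"
    by (subst nn_integral_cmult[OF gauss_integrand_measurable_UNIV[OF contf]])
       (simp add: gauss_normsq_def mult_ac)
  also have "\<dots> < \<infinity>" using fin by (simp add: ennreal_mult_less_top)
  finally have "(\<lambda>z. f z / c) \<in> fock_space"
    using disc_divisors_imp_has_zeros(1)[OF lf dd] by (simp add: fock_space_def has_zeros_def)
  then show "normalized_fock \<Lambda> \<noteq> {}"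
    using disc_divisors_imp_has_zeros[OF lf dd] by (auto simp: normalized_fock_def)
qed (auto simp: normalized_fock_def fock_zero_set_def)

lemma extremal_value_finite_iff:
  "extremal_value \<Lambda> < \<infinity> \<longleftrightarrow> normalized_fock \<Lambda> \<noteq> {}"
  unfolding extremal_value_def INF_less_iff
  by (auto simp: normalized_fock_def fock_space_def)

lemma gauss_normsq_eq_0_imp:
  assumes cont: "continuous_on UNIV d" and 0: "gauss_normsq UNIV d = 0"
  shows "d z = 0"
proof (rule ccontr)
  assume z: "d z \<noteq> 0"
  have "AE z in lborel. ennreal ((cmod (d z))\<^sup>2 * exp (- (cmod z)\<^sup>2)) = 0"
    using 0 nn_integral_0_iff_AE[OF gauss_integrand_measurable_UNIV[OF cont]]
    by (simp add: gauss_normsq_def)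
  then have AE: "AE z in lborel. d z = 0" by (auto elim!: AE_mp intro!: AE_I2 simp: ennreal_eq_0_iff mult_le_0_iff)
  have "open (d -` (- {0}))" by (intro open_vimage cont open_Compl) auto
  then obtain s where s: "s > 0" "ball z s \<subseteq> d -` (- {0})"
    using z unfolding open_contains_ball by (metis ComplI singletonD vimageI2)
  have "AE z' in lborel. z' \<notin> ball z s" using AE by eventually_elim (use s in auto)
  then have "emeasure lborel (ball z s) = 0"
    by (subst (asm) AE_iff_measurable[of "ball z s"]) auto
  then show False using s emeasure_ball[of s z] by (simp add: unit_ball_vol_2 mult_le_0_iff)
qed

text \<open>The geometric mean \<open>F\<close> of two extremal functions is again normalized with divisor \<open>\<Lambda>\<close>, and
  \<open>\<bar>f\<^sub>1\<bar>\<^sup>2 + \<bar>f\<^sub>2\<bar>\<^sup>2 = 2 \<bar>F\<bar>\<^sup>2 + (\<bar>f\<^sub>1\<bar> - \<bar>f\<^sub>2\<bar>)\<^sup>2\<close>. Since \<open>F\<close> cannot beat the extremal value, the last term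
  integrates to \<open>0\<close>. Then \<open>f\<^sub>1 / f\<^sub>2\<close> is entire of constant modulus, hence
  constant, and it is \<open>1\<close> at the origin by the normalization.\<close>

lemma extremal_unique:
  assumes lf: "locally_finite \<Lambda>" and f1: "is_extremal \<Lambda> f1" and f2: "is_extremal \<Lambda> f2"
  shows "f1 = f2"
proof -
  have n1: "f1 \<in> normalized_fock \<Lambda>" and n2: "f2 \<in> normalized_fock \<Lambda>"
    and E1: "gauss_normsq UNIV f1 = extremal_value \<Lambda>" and E2: "gauss_normsq UNIV f2 = extremal_value \<Lambda>"
    using f1 f2 by (auto simp: is_extremal_def)
  have z1: "has_zeros f1 \<Lambda>" and z2: "has_zeros f2 \<Lambda>"
    and co1: "fps_nth (fps_expansion f1 0) (\<Lambda> 0) = 1" using n1 n2 by (auto simp: normalized_fock_def)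
  have h1: "f1 holomorphic_on UNIV" and h2: "f2 holomorphic_on UNIV" using z1 z2 by (auto simp: has_zeros_def)
  obtain q where q: "q holomorphic_on UNIV" "\<And>z. f1 z = f2 z * q z" "\<And>z. q z \<noteq> 0"
  proof (rule holomorphic_quotient_of_zorder_le[OF open_UNIV h1 h2])
    show "eventually (\<lambda>u. f1 u \<noteq> 0) (at z)" "eventually (\<lambda>u. f2 u \<noteq> 0) (at z)" for z
      by (rule has_zeros_eventually_nonzero[OF z1], rule has_zeros_eventually_nonzero[OF z2])
  qed (use z1 z2 in \<open>auto simp: has_zeros_def\<close>)
  have dd2: "disc_divisor \<Lambda> r f2" if "r > 0" for r by (rule normalized_fock_disc_divisor[OF lf n2 that])
  have q0: "q 0 = 1"
  proof -
    obtain q2 where q2: "q2 holomorphic_on ball 0 1" "q2 0 = 1"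
        "\<And>z. z \<in> ball 0 1 \<Longrightarrow> f2 z = blaschke \<Lambda> 1 z * q2 z"
      using dd2[of 1] by (auto simp: disc_divisor_def)
    have "fps_nth (fps_expansion f1 0) (\<Lambda> 0) = q2 0 * q 0"
      by (rule blaschke_leading_coeff[OF lf zero_less_one])
         (auto intro!: holomorphic_intros q2 holomorphic_on_subset[OF q(1)] simp: q(2) q2(3))
    then show ?thesis using co1 q2(2) by simp
  qed
  obtain g0 where g0: "g0 holomorphic_on UNIV" "\<And>z. exp (g0 z) = q z"
    using holomorphic_logarithm_exists[of UNIV q 0] q by auto
  \<comment> \<open>the branch of the logarithm with value \<open>0\<close> at the origin; otherwise the square root of \<open>q\<close> could
     be \<open>- 1\<close> there and \<open>F\<close> would not be normalized\<close>
  define g where "g = (\<lambda>z. g0 z - g0 0)"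
  have g: "g holomorphic_on UNIV" "g 0 = 0" "\<And>z. exp (g z) = q z"
    using g0 q0 by (auto simp: g_def exp_diff intro!: holomorphic_intros)
  define F where "F = (\<lambda>z. f2 z * exp (g z / 2))"
  have holF: "F holomorphic_on UNIV" unfolding F_def by (intro holomorphic_intros h2 g) auto
  have ddF: "disc_divisor \<Lambda> r F" if r: "r > 0" for r
  proof -
    obtain q2 where q2: "q2 holomorphic_on ball 0 r" "q2 0 = 1"
        "\<And>z. z \<in> ball 0 r \<Longrightarrow> q2 z \<noteq> 0 \<and> f2 z = blaschke \<Lambda> r z * q2 z"
      using dd2[OF r] by (auto simp: disc_divisor_def)
    show ?thesis unfolding disc_divisor_def F_def
      by (rule exI[of _ "\<lambda>z. q2 z * exp (g z / 2)"])
         (auto intro!: holomorphic_intros q2(1) holomorphic_on_subset[OF g(1)] simp: q2 g(2))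
  qed
  have normF: "(cmod (F z))\<^sup>2 = cmod (f1 z) * cmod (f2 z)" for z
  proof -
    have "(exp (g z / 2))\<^sup>2 = q z" using g(3)[of z] by (simp add: exp_double[symmetric])
    then have "(cmod (exp (g z / 2)))\<^sup>2 = cmod (q z)" by (metis norm_power)
    then show ?thesis by (simp add: F_def norm_mult power_mult_distrib q(2) power2_eq_square mult_ac)
  qed
  define d where "d = (\<lambda>z. complex_of_real (cmod (f1 z) - cmod (f2 z)))"
  have cont: "continuous_on UNIV f1" "continuous_on UNIV f2" "continuous_on UNIV F" "continuous_on UNIV d"
    using holomorphic_on_imp_continuous_on[OF h1] holomorphic_on_imp_continuous_on[OF h2] holomorphic_on_imp_continuous_on[OF holF]
    unfolding d_def by (auto intro!: continuous_intros)
  have add: "gauss_normsq UNIV u + gauss_normsq UNIV v = ennreal (1 / pi) *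
      (\<integral>\<^sup>+z. ennreal (((cmod (u z))\<^sup>2 + (cmod (v z))\<^sup>2) * exp (- (cmod z)\<^sup>2)) \<partial>lborel)"
    if "continuous_on UNIV u" "continuous_on UNIV v" for u v
    using that[THEN gauss_integrand_measurable_UNIV]
    by (simp add: gauss_normsq_def distrib_left[symmetric] nn_integral_add[symmetric] ennreal_plus[symmetric] distrib_right del: ennreal_plus)
  have "gauss_normsq UNIV f1 + gauss_normsq UNIV f2 =
      gauss_normsq UNIV (\<lambda>z. sqrt 2 * F z) + gauss_normsq UNIV d"
  proof -
    have "(cmod (f1 z))\<^sup>2 + (cmod (f2 z))\<^sup>2 = (cmod (sqrt 2 * F z))\<^sup>2 + (cmod (d z))\<^sup>2" for z
    proof -
      have "(cmod (sqrt 2 * F z))\<^sup>2 = 2 * (cmod (f1 z) * cmod (f2 z))"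
        by (simp add: norm_mult power_mult_distrib normF)
      moreover have "(cmod (d z))\<^sup>2 = (cmod (f1 z) - cmod (f2 z))\<^sup>2" by (simp add: d_def flip: of_real_diff)
      ultimately show ?thesis by (simp add: power2_diff)
    qed
    then show ?thesis
      using cont by (subst (1 2) add) (auto intro!: continuous_intros)
  qed
  also have "gauss_normsq UNIV (\<lambda>z. sqrt 2 * F z) = gauss_normsq UNIV F + gauss_normsq UNIV F"
    by (subst add[OF cont(3) cont(3)]) (simp add: gauss_normsq_def norm_mult power_mult_distrib)
  finally have sum: "extremal_value \<Lambda> + extremal_value \<Lambda> =
      gauss_normsq UNIV F + gauss_normsq UNIV F + gauss_normsq UNIV d"
    by (simp add: E1 E2)
  have fin: "extremal_value \<Lambda> < \<infinity>" using n1 extremal_value_finite_iff by blast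
  then have "gauss_normsq UNIV F < \<infinity>"
  proof -
    have "gauss_normsq UNIV F \<le> extremal_value \<Lambda> + extremal_value \<Lambda>"
      unfolding sum by (metis add.assoc le_iff_add)
    also have "\<dots> < \<infinity>" using fin by simp
    finally show ?thesis .
  qed
  then have "F \<in> normalized_fock \<Lambda>"
    using disc_divisors_imp_has_zeros[OF lf ddF] holF by (simp add: normalized_fock_def fock_space_def)
  then have "extremal_value \<Lambda> \<le> gauss_normsq UNIV F"
    unfolding extremal_value_def by (rule INF_lower)
  then have "extremal_value \<Lambda> + extremal_value \<Lambda> + gauss_normsq UNIV d
      \<le> gauss_normsq UNIV F + gauss_normsq UNIV F + gauss_normsq UNIV d"
    by (intro add_mono) auto
  also have "\<dots> = extremal_value \<Lambda> + extremal_value \<Lambda>" by (rule sum[symmetric])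
  finally have d0: "gauss_normsq UNIV d = 0"
    using fin by (cases "extremal_value \<Lambda>"; cases "gauss_normsq UNIV d")
      (auto simp: ennreal_plus[symmetric] top_unique simp del: ennreal_plus)
  have eq: "cmod (f1 z) = cmod (f2 z)" for z
    using gauss_normsq_eq_0_imp[OF cont(4) d0, of z] by (simp add: d_def)
  have q1: "cmod (q z) = 1" for z
  proof -
    have "eventually (\<lambda>u. cmod (q u) = 1) (at z)"
      using has_zeros_eventually_nonzero[OF z2, of z]
    proof eventually_elim
      case (elim u)
      then show ?case using eq[of u] q(2)[of u] by (simp add: norm_mult)
    qed
    moreover have "((\<lambda>u. cmod (q u)) \<longlongrightarrow> cmod (q z)) (at z)"
      using holomorphic_on_imp_continuous_on[OF q(1)]
      by (intro tendsto_norm) (simp add: continuous_on_eq_continuous_at isCont_def)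
    ultimately have "((\<lambda>_. 1) \<longlongrightarrow> cmod (q z)) (at z)" by (rule Lim_transform_eventually[rotated])
    then show ?thesis using LIM_unique[OF tendsto_const] by metis
  qed
  have "bounded (range q)" using q1 by (auto simp: bounded_iff)
  then obtain c where "\<And>z. q z = c"
    using Liouville_theorem[OF q(1)] unfolding constant_on_def by auto
  then have "q z = 1" for z using q0 by metis
  then show ?thesis by (auto simp: fun_eq_iff q(2))
qed

section \<open>Convergence of the minima and of the minimizers\<close>

lemma subsequence_of_minimizers:
  assumes lf: "locally_finite \<Lambda>" and adm: "admissible_radii \<Lambda> p R"
    and s: "strict_mono s" "\<And>n. s n \<ge> 1"
    and a: "\<And>n. is_minimizer \<Lambda> p R (s n) (a (s n))"
    and c: "\<And>n. finite_min \<Lambda> p R (s n) \<le> c" "c < \<infinity>"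
  obtains r g where "strict_mono (r :: nat \<Rightarrow> nat)" "g \<in> normalized_fock \<Lambda>"
    "\<And>K. compact K \<Longrightarrow> uniform_limit K (\<lambda>n. competitor \<Lambda> p (R (s (r n))) (a (s (r n)))) g sequentially"
    "gauss_normsq UNIV g \<le> liminf (\<lambda>n. finite_min \<Lambda> p R (s (r n)))"
proof -
  obtain M where M: "c = ennreal M" "M \<ge> 0" using c(2) by (cases c) auto
  have R: "real (s n) \<le> R (s n)" for n using adm s(2)[of n] by (force simp: admissible_radii_def)
  have min: "gauss_normsq (ball 0 (real (s n))) (competitor \<Lambda> p (R (s n)) (a (s n))) = finite_min \<Lambda> p R (s n)" for n
    using a by (simp add: is_minimizer_def)
  show ?thesis
  proof (rule normalized_limit_of_disc_divisors[OF lf, of "\<lambda>n. real (s n)"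
        "\<lambda>n. competitor \<Lambda> p (R (s n)) (a (s n))" M])
    show "filterlim (\<lambda>n. real (s n)) at_top sequentially"
      by (rule filterlim_compose[OF filterlim_real_sequentially filterlim_subseq[OF s(1)]])
    show "disc_divisor \<Lambda> (real (s n)) (competitor \<Lambda> p (R (s n)) (a (s n)))" for n
      using s(2)[of n] R[of n] by (intro competitor_disc_divisor[OF lf]) auto
    show "gauss_normsq (ball 0 (real (s n))) (competitor \<Lambda> p (R (s n)) (a (s n))) \<le> ennreal M" for n
      using c(1) by (simp add: min M)
  qed (use M(2) that in \<open>simp_all add: min\<close>)
qed

lemma admissible_imp_attained:
  assumes lf: "locally_finite \<Lambda>" and adm: "admissible_radii \<Lambda> p R" and k: "k \<ge> 1"
  shows "\<exists>a. is_minimizer \<Lambda> p R k a"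
  using adm k by (intro finite_min_attained[OF lf k]) (force simp: admissible_radii_def)

text \<open>For the lower bound, infinitely many minima at most \<open>c < M(\<Lambda>)\<close> would by compactness produce a
  normalized function of norm at most \<open>c\<close>.\<close>

lemma finite_min_tendsto_extremal_value:
  assumes lf: "locally_finite \<Lambda>" and adm: "admissible_radii \<Lambda> p R"
  shows "finite_min \<Lambda> p R \<longlonglongrightarrow> extremal_value \<Lambda>"
proof (rule Liminf_eq_Limsup)
  let ?E = "finite_min \<Lambda> p R"
  have upper: "limsup ?E \<le> extremal_value \<Lambda>"
    unfolding extremal_value_def
  proof (rule INF_greatest)
    fix f assume "f \<in> normalized_fock \<Lambda>"
    then obtain a where a: "(\<lambda>k. gauss_normsq (ball 0 (real k)) (competitor \<Lambda> p (R k) (a k))) \<longlonglongrightarrow> gauss_normsq UNIV f"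
      using competitors_approximating_normalized_fock[OF lf _ adm] by blast
    have "limsup ?E \<le> limsup (\<lambda>k. gauss_normsq (ball 0 (real k)) (competitor \<Lambda> p (R k) (a k)))"
      unfolding finite_min_def by (intro Limsup_mono always_eventually allI INF_lower) auto
    also have "\<dots> = gauss_normsq UNIV f" by (rule lim_imp_Limsup[OF _ a]) simp
    finally show "limsup ?E \<le> gauss_normsq UNIV f" .
  qed
  obtain a where a: "\<And>k. k \<ge> 1 \<Longrightarrow> is_minimizer \<Lambda> p R k (a k)"
    using admissible_imp_attained[OF lf adm] by metis
  have lower: "extremal_value \<Lambda> \<le> liminf ?E"
  proof (rule ccontr)
    assume "\<not> ?thesis"
    then obtain c where c: "c < extremal_value \<Lambda>" "\<not> eventually (\<lambda>k. c < ?E k) sequentially"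
      unfolding le_Liminf_iff by blast
    have "\<exists>k\<ge>m. ?E k \<le> c" for m
      using c(2) unfolding eventually_sequentially by (meson not_le)
    then have "infinite {k. k \<ge> 1 \<and> ?E k \<le> c}"
      unfolding infinite_nat_iff_unbounded_le by (metis (mono_tags, lifting) le_trans max.cobounded1 max.cobounded2 mem_Collect_eq)
    then obtain s :: "nat \<Rightarrow> nat" where s: "strict_mono s" "\<And>n. s n \<ge> 1" "\<And>n. ?E (s n) \<le> c"
      using infinite_enumerate by (metis (mono_tags, lifting) mem_Collect_eq)
    have "c < \<infinity>" using c(1) by (metis infinity_ennreal_def less_le_trans top_greatest)
    then obtain r g where g: "g \<in> normalized_fock \<Lambda>" "gauss_normsq UNIV g \<le> liminf (\<lambda>n. ?E (s (r n)))"
      using subsequence_of_minimizers[OF lf adm s(1,2) a[OF s(2)] s(3)] by blast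
    have "extremal_value \<Lambda> \<le> gauss_normsq UNIV g" unfolding extremal_value_def by (rule INF_lower[OF g(1)])
    also note g(2)
    also have "liminf (\<lambda>n. ?E (s (r n))) \<le> limsup (\<lambda>n. ?E (s (r n)))" by (intro Liminf_le_Limsup) auto
    also have "\<dots> \<le> c" by (intro Limsup_bounded always_eventually allI s)
    finally show False using c(1) by simp
  qed
  have "liminf ?E \<le> limsup ?E" by (intro Liminf_le_Limsup) auto
  with upper lower show "liminf ?E = extremal_value \<Lambda>" "limsup ?E = extremal_value \<Lambda>" by auto
qed simp

text \<open>Since the minima converge to the finite extremal value, they are eventually bounded, and the limit
  produced by compactness has norm at most that value.\<close>

lemma minimizers_subconverge_to_extremal:
  assumes lf: "locally_finite \<Lambda>" and adm: "admissible_radii \<Lambda> p R" and fin: "extremal_value \<Lambda> < \<infinity>"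
    and a: "\<And>k. k \<ge> 1 \<Longrightarrow> is_minimizer \<Lambda> p R k (a k)" and s: "strict_mono (s :: nat \<Rightarrow> nat)"
  obtains t g where "strict_mono (t :: nat \<Rightarrow> nat)" "is_extremal \<Lambda> g"
    "\<And>K. compact K \<Longrightarrow> uniform_limit K (\<lambda>n. competitor \<Lambda> p (R (s (t n))) (a (s (t n)))) g sequentially"
proof -
  let ?E = "finite_min \<Lambda> p R"
  have lim: "?E \<longlonglongrightarrow> extremal_value \<Lambda>" by (rule finite_min_tendsto_extremal_value[OF lf adm])
  have "extremal_value \<Lambda> < extremal_value \<Lambda> + 1"
    using fin by (cases "extremal_value \<Lambda>") (auto simp: ennreal_lessI simp flip: ennreal_1 ennreal_plus)
  then have "eventually (\<lambda>k. ?E k < extremal_value \<Lambda> + 1) sequentially"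
    by (rule order_tendstoD(2)[OF lim])
  then obtain m where m: "\<And>k. k \<ge> m \<Longrightarrow> ?E k < extremal_value \<Lambda> + 1"
    unfolding eventually_sequentially by blast
  \<comment> \<open>\<open>Suc m\<close> also skips the index \<open>0\<close>, where nothing is assumed about \<open>a\<close>\<close>
  define s' where "s' = (\<lambda>n. s (n + Suc m))"
  have s': "strict_mono s'" "\<And>n. s' n \<ge> Suc m"
    using s le_trans[OF le_add2 seq_suble[OF s]] by (auto simp: s'_def strict_mono_def simp del: add_Suc_right)
  have s1: "s' n \<ge> 1" and E: "?E (s' n) \<le> extremal_value \<Lambda> + 1" for n
    using s'(2)[of n] by (auto intro!: less_imp_le m)
  obtain r g where r: "strict_mono (r :: nat \<Rightarrow> nat)" and g: "g \<in> normalized_fock \<Lambda>"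
    and ul: "\<And>K. compact K \<Longrightarrow> uniform_limit K (\<lambda>n. competitor \<Lambda> p (R (s' (r n))) (a (s' (r n)))) g sequentially"
    and le: "gauss_normsq UNIV g \<le> liminf (\<lambda>n. ?E (s' (r n)))"
    using subsequence_of_minimizers[OF lf adm s'(1) s1 a[OF s1] E] fin by auto
  have "(\<lambda>n. ?E (s' (r n))) \<longlonglongrightarrow> extremal_value \<Lambda>"
    using LIMSEQ_subseq_LIMSEQ[OF lim strict_mono_o[OF s'(1) r]] by (simp add: o_def)
  then have "liminf (\<lambda>n. ?E (s' (r n))) = extremal_value \<Lambda>" by (rule lim_imp_Liminf[rotated]) simp
  then have "gauss_normsq UNIV g = extremal_value \<Lambda>"
    using le INF_lower[OF g, of "gauss_normsq UNIV"] by (simp add: extremal_value_def antisym)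
  with g have "is_extremal \<Lambda> g" by (simp add: is_extremal_def)
  moreover have "strict_mono (\<lambda>n. r n + Suc m)" using r by (simp add: strict_mono_def)
  ultimately show ?thesis using ul unfolding s'_def by (intro that[of "\<lambda>n. r n + Suc m" g]) auto
qed

text \<open>A subsequence staying at distance \<open>e\<close> from \<open>f\<close> on \<open>K\<close> would have a further subsequence converging
  to an extremal function, which is \<open>f\<close> by uniqueness.\<close>

lemma minimizers_converge:
  assumes lf: "locally_finite \<Lambda>" and adm: "admissible_radii \<Lambda> p R"
    and f: "is_extremal \<Lambda> f" and a: "\<And>k. k \<ge> 1 \<Longrightarrow> is_minimizer \<Lambda> p R k (a k)" and K: "compact K"
  shows "uniform_limit K (\<lambda>k. competitor \<Lambda> p (R k) (a k)) f sequentially"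
proof (rule ccontr)
  assume "\<not> ?thesis"
  then obtain e where e: "e > 0"
      "\<not> eventually (\<lambda>k. \<forall>x\<in>K. dist (competitor \<Lambda> p (R k) (a k) x) (f x) < e) sequentially"
    unfolding uniform_limit_iff by blast
  define B where "B = {k. \<not> (\<forall>x\<in>K. dist (competitor \<Lambda> p (R k) (a k) x) (f x) < e)}"
  have "infinite B"
    using e(2) unfolding B_def infinite_nat_iff_unbounded_le eventually_sequentially by blast
  then obtain s :: "nat \<Rightarrow> nat" where s: "strict_mono s" "\<And>n. s n \<in> B" using infinite_enumerate by blast
  have fin: "extremal_value \<Lambda> < \<infinity>" using f extremal_value_finite_iff by (auto simp: is_extremal_def)
  obtain t g where t: "strict_mono (t :: nat \<Rightarrow> nat)" and g: "is_extremal \<Lambda> g"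
    and ul: "\<And>K. compact K \<Longrightarrow> uniform_limit K (\<lambda>n. competitor \<Lambda> p (R (s (t n))) (a (s (t n)))) g sequentially"
    using minimizers_subconverge_to_extremal[OF lf adm fin a s(1)] by blast
  have "g = f" by (rule extremal_unique[OF lf g f])
  then have "eventually (\<lambda>n. \<forall>x\<in>K. dist (competitor \<Lambda> p (R (s (t n))) (a (s (t n))) x) (f x) < e) sequentially"
    using ul[OF K] e(1) unfolding uniform_limit_iff by blast
  moreover have "\<not> (\<forall>x\<in>K. dist (competitor \<Lambda> p (R (s (t n))) (a (s (t n))) x) (f x) < e)" for n
    using s(2)[of "t n"] unfolding B_def by blast
  ultimately show False by simp
qed

lemma extremal_exists:
  assumes lf: "locally_finite \<Lambda>" and adm: "admissible_radii \<Lambda> p R" and fin: "extremal_value \<Lambda> < \<infinity>"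
  shows "\<exists>f. is_extremal \<Lambda> f"
proof -
  obtain a where a: "\<And>k. k \<ge> 1 \<Longrightarrow> is_minimizer \<Lambda> p R k (a k)"
    using admissible_imp_attained[OF lf adm] by metis
  show ?thesis
    by (rule minimizers_subconverge_to_extremal[OF lf adm fin a strict_mono_id]) blast+
qed

section \<open>Existence of admissible radii\<close>

lemma delta_le:
  assumes "R \<ge> 1"
  shows "delta \<Lambda> R \<le> R\<^sup>2 / 2"
proof -
  have "jensen_sum \<Lambda> R \<ge> 0"
    unfolding jensen_sum_def
    using assms by (intro add_nonneg_nonneg sum_nonneg mult_nonneg_nonneg ln_ge_zero) auto
  then show ?thesis unfolding delta_def by (intro max.boundedI) auto
qed

lemma admissible_cubic_radii: "admissible_radii \<Lambda> 2 (\<lambda>k. 2 * real k ^ 3)"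
  unfolding admissible_radii_def
proof (intro allI impI conjI)
  fix k :: nat assume k: "1 \<le> k"
  have k3: "real k \<le> real k ^ 3" using k by (intro self_le_power) auto
  then show "2 * real k \<le> 2 * real k ^ 3" by simp
  have k6: "1 \<le> real k ^ 6" using k by (intro one_le_power) auto
  have "defect \<Lambda> (2 * real k ^ 3) \<le> 1 + (2 * real k ^ 3)\<^sup>2 / 2"
    unfolding defect_def using k k3 by (intro add_left_mono delta_le) linarith
  also have "\<dots> = 1 + 2 * real k ^ 6" by (simp add: power2_eq_square flip: power_add)
  also have "\<dots> \<le> 8 * real k ^ 6" using k6 by simp
  finally have d: "defect \<Lambda> (2 * real k ^ 3) \<le> 8 * real k ^ 6" .
  have "real k / (2 * real k ^ 3) = 1 / (2 * real k ^ 2)" using k by (simp add: power2_eq_square power3_eq_cube)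
  then have "(real k / (2 * real k ^ 3)) ^ (2 + 1) = 1 / (8 * real k ^ 6)"
    by (simp add: power_divide power_mult_distrib flip: power_mult)
  then show "defect \<Lambda> (2 * real k ^ 3) * (real k / (2 * real k ^ 3)) ^ (2 + 1) \<le> 1"
    using d k by simp
qed

text \<open>At the threshold \<open>1 / (2 k\<^bsup>p+1\<^esup>)\<close> for \<open>\<delta>(R) / R\<^bsup>p+1\<^esup>\<close>, the two summands \<open>1\<close> and \<open>\<delta>(R)\<close> of the
  defect contribute at most one half each; for the first one \<open>R \<ge> 2 k\<close> suffices.\<close>

lemma admissible_radii_exist:
  assumes lim: "Liminf at_top (\<lambda>R. ereal (delta \<Lambda> R / R ^ (p + 1))) = 0"
  shows "\<exists>R. admissible_radii \<Lambda> p R"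
proof -
  have "\<exists>R. 2 * real k \<le> R \<and> defect \<Lambda> R * (real k / R) ^ (p + 1) \<le> 1" if k: "k \<ge> 1" for k :: nat
  proof -
    define y where "y = 1 / (2 * real k ^ (p + 1))"
    have y: "y > 0" using k by (simp add: y_def)
    have "\<not> eventually (\<lambda>R. ereal y \<le> ereal (delta \<Lambda> R / R ^ (p + 1))) at_top"
      using Liminf_bounded[of "ereal y" "\<lambda>R. ereal (delta \<Lambda> R / R ^ (p + 1))" at_top] y lim by auto
    then obtain R where R: "R \<ge> 2 * real k" "delta \<Lambda> R / R ^ (p + 1) < y"
      unfolding eventually_at_top_linorder by (auto simp: not_le)
    have R0: "R > 0" using R k by linarith
    have "(real k / R) ^ (p + 1) \<le> (1 / 2) ^ (p + 1)"
      using R R0 by (intro power_mono) (auto simp: field_simps)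
    also have "\<dots> \<le> 1 / 2" by (simp add: power_le_one)
    finally have 1: "(real k / R) ^ (p + 1) \<le> 1 / 2" .
    have "delta \<Lambda> R * (real k / R) ^ (p + 1) = delta \<Lambda> R / R ^ (p + 1) * real k ^ (p + 1)"
      by (simp add: power_divide)
    also have "\<dots> \<le> y * real k ^ (p + 1)" using R by (intro mult_right_mono) auto
    also have "\<dots> = 1 / 2" using k by (simp add: y_def)
    finally have "defect \<Lambda> R * (real k / R) ^ (p + 1) \<le> 1"
      using 1 by (simp only: defect_def distrib_right mult_1)
    with R show ?thesis by blast
  qed
  then show ?thesis unfolding admissible_radii_def by metis
qed

theorem proposition2p3:
  fixes \<Lambda> :: "complex \<Rightarrow> nat"
  assumes "locally_finite \<Lambda>"
  shows
    "(\<forall>p\<in>{0, 1, 2}. \<forall>R. admissible_radii \<Lambda> p R \<longrightarrow>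
        (\<forall>k\<ge>1. \<exists>a. is_minimizer \<Lambda> p R k a) \<and>
        finite_min \<Lambda> p R \<longlonglongrightarrow> extremal_value \<Lambda> \<and>
        (fock_zero_set \<Lambda> \<longleftrightarrow> lim (finite_min \<Lambda> p R) < \<infinity>) \<and>
        (extremal_value \<Lambda> < \<infinity> \<longrightarrow>
          (\<exists>!f. is_extremal \<Lambda> f) \<and>
          (\<forall>f a. is_extremal \<Lambda> f \<and> (\<forall>k\<ge>1. is_minimizer \<Lambda> p R k (a k)) \<longrightarrow>
            (\<forall>K. compact K \<longrightarrow>
              uniform_limit K (\<lambda>k. competitor \<Lambda> p (R k) (a k)) f sequentially)))) \<and>
     admissible_radii \<Lambda> 2 (\<lambda>k. 2 * real k ^ 3) \<and>
     (Liminf at_top (\<lambda>R. ereal (delta \<Lambda> R / R\<^sup>2)) = 0 \<longrightarrow> (\<exists>R. admissible_radii \<Lambda> 1 R)) \<and>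
     (Liminf at_top (\<lambda>R. ereal (delta \<Lambda> R / R)) = 0 \<longrightarrow> (\<exists>R. admissible_radii \<Lambda> 0 R))"
proof (intro conjI ballI allI impI admissible_cubic_radii)
  fix p R assume adm: "admissible_radii \<Lambda> p R"
  note lf = assms
  show "\<exists>a. is_minimizer \<Lambda> p R k a" if "k \<ge> 1" for k
    by (rule admissible_imp_attained[OF lf adm that])
  show lim: "finite_min \<Lambda> p R \<longlonglongrightarrow> extremal_value \<Lambda>"
    by (rule finite_min_tendsto_extremal_value[OF lf adm])
  show "fock_zero_set \<Lambda> \<longleftrightarrow> lim (finite_min \<Lambda> p R) < \<infinity>"
    unfolding limI[OF lim] fock_zero_set_iff_normalized[OF lf] extremal_value_finite_iff ..
  show "\<exists>!f. is_extremal \<Lambda> f" if "extremal_value \<Lambda> < \<infinity>"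
    using extremal_exists[OF lf adm that] extremal_unique[OF lf] by blast
  show "uniform_limit K (\<lambda>k. competitor \<Lambda> p (R k) (a k)) f sequentially"
    if "is_extremal \<Lambda> f \<and> (\<forall>k\<ge>1. is_minimizer \<Lambda> p R k (a k))" "compact K" for f a K
    using that by (intro minimizers_converge[OF lf adm]) auto
next
  assume "Liminf at_top (\<lambda>R. ereal (delta \<Lambda> R / R\<^sup>2)) = 0"
  then show "\<exists>R. admissible_radii \<Lambda> 1 R"
    by (intro admissible_radii_exist) (simp add: numeral_2_eq_2)
next
  assume "Liminf at_top (\<lambda>R. ereal (delta \<Lambda> R / R)) = 0"
  then show "\<exists>R. admissible_radii \<Lambda> 0 R"
    by (intro admissible_radii_exist) simp
qed

end
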